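(* Let $X,Y$ be Banach spaces and let $T\colon X\to Y$ be a bounded operator. (i) If $T$ is tauberian and $(M,N)$ is a tauberian pair of closed subspaces of $Y$, then $(T^{-1}(M),T^{-1}(N))$ is a tauberian pair of closed subspaces of $X$. (ii) If $T$ is cotauberian and $(M,N)$ is a cotauberian pair of closed subspaces of $X$, then $(\overline{T(M)},\overline{T(N)})$ is a cotauberian pair of closed subspaces of $Y$.
   Context: $T^{-1}(\cdot)$ denotes the preimage. A Banach space $X$ is identified with its canonical image in $X^{**}$. A bounded operator $S\colon X\to Y$ between Banach spaces is tauberian if $S^{**}(X^{**}\setminus X)\subset Y^{**}\setminus Y$, and cotauberian if its conjugate $S^*\colon Y^*\to X^*$ is tauberian. For a closed subspace $M$ of a Banach space $Z$, $J_M\colon M\to Z$ is the inclusion and $Q_M\colon Z\to Z/M$ the quotient map. A pair $(M,N)$ of closed subspaces of $Z$ is tauberian (respectively cotauberian) if the operator $Q_NJ_M\colon M\to Z/N$ is tauberian (respectively cotauberian). *)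

theory Defs
  imports
    "HOL-Analysis.Abstract_Metric_Spaces"
    "HOL-Algebra.AbelCoset"
    "HOL-Algebra.Module"
begin

section \<open>Scalars\<close>

text \<open>The scalar field is either the reals or the complex numbers. In the second alternative
  multiplicativity of the norm forces it to be the usual modulus.\<close>

class real_or_complex = real_normed_field +
  assumes real_or_complex:
    "(\<forall>z. \<exists>a. z = a *\<^sub>R 1) \<or> (\<exists>i. i * i = - 1 \<and> (\<forall>z. \<exists>a b. z = a *\<^sub>R 1 + b *\<^sub>R i))"

instance real :: real_or_complex
  by standard auto

instance complex :: real_or_complex
proof
  have "z = Re z *\<^sub>R 1 + Im z *\<^sub>R imaginary_unit" for z
    by (simp add: complex_eq_iff)
  then have "imaginary_unit * imaginary_unit = - 1 \<and> (\<forall>z. \<exists>a b. z = a *\<^sub>R 1 + b *\<^sub>R imaginary_unit)"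
    by (metis i_squared)
  then show "(\<forall>z::complex. \<exists>a. z = a *\<^sub>R 1) \<or>
      (\<exists>i::complex. i * i = - 1 \<and> (\<forall>z. \<exists>a b. z = a *\<^sub>R 1 + b *\<^sub>R i))"
    by blast
qed


section \<open>Normed spaces and Banach spaces with explicit carrier\<close>

text \<open>Subspaces, quotients and duals have to be normed spaces of their own, so normed spaces are
  HOL-Algebra modules over the scalar field with a norm added. The fields \<open>mult\<close> and \<open>one\<close>, which
  the library record \<open>module\<close> inherits from \<open>ring\<close>, matter only for \<open>scalar_space\<close>, which serves both as
  the ring of scalars and as the one-dimensional target space of functionals.\<close>

record ('k, 'a) normed_module = "('k, 'a) module" +
  vnorm :: "'a \<Rightarrow> real"

definition scalar_space :: "('k::real_or_complex, 'k) normed_module" where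
  "scalar_space = \<lparr>carrier = UNIV, monoid.mult = (*), one = 1, ring.zero = 0, add = (+),
     smult = (*), vnorm = norm\<rparr>"

locale normed_space = module scalar_space X
  for X :: "('k::real_or_complex, 'a) normed_module" (structure) +
  assumes vnorm_nonneg: "x \<in> carrier X \<Longrightarrow> 0 \<le> vnorm X x"
    and vnorm_eq_0_iff: "x \<in> carrier X \<Longrightarrow> vnorm X x = 0 \<longleftrightarrow> x = \<zero>"
    and vnorm_triangle: "x \<in> carrier X \<Longrightarrow> y \<in> carrier X \<Longrightarrow> vnorm X (x \<oplus> y) \<le> vnorm X x + vnorm X y"
    and vnorm_smult: "x \<in> carrier X \<Longrightarrow> vnorm X (c \<odot> x) = norm c * vnorm X x"

text \<open>The value off the carrier only serves the locale \<open>Metric_space\<close>, which requires a distance to be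
  nonnegative and symmetric everywhere.\<close>

definition vdist :: "('k, 'a) normed_module \<Rightarrow> 'a \<Rightarrow> 'a \<Rightarrow> real" where
  "vdist X x y = (if x \<in> carrier X \<and> y \<in> carrier X then vnorm X (x \<ominus>\<^bsub>X\<^esub> y) else 0)"

abbreviation norm_topology :: "('k, 'a) normed_module \<Rightarrow> 'a topology" where
  "norm_topology X \<equiv> Metric_space.mtopology (carrier X) (vdist X)"

locale banach_space = normed_space +
  assumes complete: "Metric_space.mcomplete (carrier X) (vdist X)"

definition closed_subspace :: "('k::real_or_complex, 'a) normed_module \<Rightarrow> 'a set \<Rightarrow> bool" where
  "closed_subspace Z M \<longleftrightarrow> submodule M scalar_space Z \<and> closedin (norm_topology Z) M"


section \<open>Bounded operators and duality\<close>

definition bounded_operator ::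
    "('k::real_or_complex, 'a) normed_module \<Rightarrow> ('k, 'b) normed_module \<Rightarrow> ('a \<Rightarrow> 'b) \<Rightarrow> bool" where
  "bounded_operator X Y S \<longleftrightarrow>
     S \<in> carrier X \<rightarrow> carrier Y \<and>
     (\<forall>x\<in>carrier X. \<forall>y\<in>carrier X. S (x \<oplus>\<^bsub>X\<^esub> y) = S x \<oplus>\<^bsub>Y\<^esub> S y) \<and>
     (\<forall>c. \<forall>x\<in>carrier X. S (c \<odot>\<^bsub>X\<^esub> x) = c \<odot>\<^bsub>Y\<^esub> S x) \<and>
     (\<exists>C. \<forall>x\<in>carrier X. vnorm Y (S x) \<le> C * vnorm X x)"

text \<open>Functionals are extensional, i.e. \<open>undefined\<close> off the carrier, so that equality of functionals is
  equality on the carrier.\<close>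

definition dual_space :: "('k::real_or_complex, 'a) normed_module \<Rightarrow> ('k, 'a \<Rightarrow> 'k) normed_module" where
  "dual_space X = \<lparr>carrier = {f \<in> extensional (carrier X). bounded_operator X scalar_space f},
     monoid.mult = undefined, one = undefined,
     ring.zero = (\<lambda>x\<in>carrier X. 0), add = (\<lambda>f g. \<lambda>x\<in>carrier X. f x + g x),
     smult = (\<lambda>c f. \<lambda>x\<in>carrier X. c * f x),
     vnorm = (\<lambda>f. SUP x\<in>{x \<in> carrier X. vnorm X x \<le> 1}. norm (f x))\<rparr>"

abbreviation bidual_space ::
    "('k::real_or_complex, 'a) normed_module \<Rightarrow> ('k, ('a \<Rightarrow> 'k) \<Rightarrow> 'k) normed_module" where
  "bidual_space X \<equiv> dual_space (dual_space X)"

text \<open>The conjugate \<open>S\<^sup>* : Y\<^sup>* \<rightarrow> X\<^sup>*\<close> of \<open>S : X \<rightarrow> Y\<close>.\<close>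

definition conjugate :: "('k::real_or_complex, 'a) normed_module \<Rightarrow> ('k, 'b) normed_module \<Rightarrow>
    ('a \<Rightarrow> 'b) \<Rightarrow> ('b \<Rightarrow> 'k) \<Rightarrow> ('a \<Rightarrow> 'k)" where
  "conjugate X Y S = (\<lambda>g\<in>carrier (dual_space Y). \<lambda>x\<in>carrier X. g (S x))"

abbreviation biconjugate :: "('k::real_or_complex, 'a) normed_module \<Rightarrow> ('k, 'b) normed_module \<Rightarrow>
    ('a \<Rightarrow> 'b) \<Rightarrow> (('a \<Rightarrow> 'k) \<Rightarrow> 'k) \<Rightarrow> (('b \<Rightarrow> 'k) \<Rightarrow> 'k)" where
  "biconjugate X Y S \<equiv> conjugate (dual_space Y) (dual_space X) (conjugate X Y S)"

definition canonical_image :: "('k::real_or_complex, 'a) normed_module \<Rightarrow> (('a \<Rightarrow> 'k) \<Rightarrow> 'k) set" where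
  "canonical_image X = (\<lambda>x. \<lambda>f\<in>carrier (dual_space X). f x) ` carrier X"


section \<open>Tauberian and cotauberian operators and pairs\<close>

definition tauberian ::
    "('k::real_or_complex, 'a) normed_module \<Rightarrow> ('k, 'b) normed_module \<Rightarrow> ('a \<Rightarrow> 'b) \<Rightarrow> bool" where
  "tauberian X Y S \<longleftrightarrow> bounded_operator X Y S \<and>
     biconjugate X Y S ` (carrier (bidual_space X) - canonical_image X)
       \<subseteq> carrier (bidual_space Y) - canonical_image Y"

definition cotauberian ::
    "('k::real_or_complex, 'a) normed_module \<Rightarrow> ('k, 'b) normed_module \<Rightarrow> ('a \<Rightarrow> 'b) \<Rightarrow> bool" where
  "cotauberian X Y S \<longleftrightarrow> bounded_operator X Y S \<and>
     tauberian (dual_space Y) (dual_space X) (conjugate X Y S)"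

definition subspace_of :: "('k, 'a) normed_module \<Rightarrow> 'a set \<Rightarrow> ('k, 'a) normed_module" where
  "subspace_of Z M = Z\<lparr>carrier := M\<rparr>"

text \<open>As for \<open>rcoset_mult\<close> in the library, scalar multiplication is the union over all representatives
  of one and the same coset. The norm is the infimum of the norm over the coset.\<close>

definition quotient_space :: "('k, 'a) normed_module \<Rightarrow> 'a set \<Rightarrow> ('k, 'a set) normed_module" where
  "quotient_space Z N = \<lparr>carrier = a_rcosets\<^bsub>Z\<^esub> N, monoid.mult = undefined, one = undefined,
     ring.zero = N, add = set_add Z,
     smult = (\<lambda>c A. \<Union>z\<in>A. N +>\<^bsub>Z\<^esub> (c \<odot>\<^bsub>Z\<^esub> z)),
     vnorm = (\<lambda>A. INF z\<in>A. vnorm Z z)\<rparr>"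

definition inclusion_operator :: "'a set \<Rightarrow> 'a \<Rightarrow> 'a" where
  "inclusion_operator M = (\<lambda>x\<in>M. x)"

definition quotient_operator :: "('k, 'a) normed_module \<Rightarrow> 'a set \<Rightarrow> 'a \<Rightarrow> 'a set" where
  "quotient_operator Z N = (\<lambda>z\<in>carrier Z. N +>\<^bsub>Z\<^esub> z)"

definition tauberian_pair :: "('k::real_or_complex, 'a) normed_module \<Rightarrow> 'a set \<Rightarrow> 'a set \<Rightarrow> bool" where
  "tauberian_pair Z M N \<longleftrightarrow> closed_subspace Z M \<and> closed_subspace Z N \<and>
     tauberian (subspace_of Z M) (quotient_space Z N) (quotient_operator Z N \<circ> inclusion_operator M)"

definition cotauberian_pair :: "('k::real_or_complex, 'a) normed_module \<Rightarrow> 'a set \<Rightarrow> 'a set \<Rightarrow> bool" where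
  "cotauberian_pair Z M N \<longleftrightarrow> closed_subspace Z M \<and> closed_subspace Z N \<and>
     cotauberian (subspace_of Z M) (quotient_space Z N) (quotient_operator Z N \<circ> inclusion_operator M)"

end

theory Submission
  imports Defs
begin

text \<open>Tauberian operators are closed under composition, and if a composition \<open>R S\<close> is tauberian then
  so is \<open>S\<close>, because \<open>R\<^sup>*\<^sup>*\<close> maps the canonical image into the canonical image. Dually, cotauberian operators
  are closed under composition, and if \<open>R S\<close> is cotauberian then so is \<open>R\<close>. By the Hahn-Banach theorem
  inclusions of closed subspaces are tauberian and quotient maps are cotauberian.

  For (i) put \<open>M' = T\<^sup>-\<^sup>1(M)\<close>, \<open>N' = T\<^sup>-\<^sup>1(N)\<close>. The restriction \<open>T\<^sub>M : M' \<rightarrow> M\<close> is tauberian since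
  \<open>J\<^sub>M T\<^sub>M = T J\<^sub>M\<^sub>'\<close>, hence so is \<open>Q\<^sub>N J\<^sub>M T\<^sub>M\<close>, which factors through \<open>Q\<^sub>N\<^sub>' J\<^sub>M\<^sub>'\<close> by the operator
  \<open>X/N' \<rightarrow> Y/N\<close> induced by \<open>T\<close>. For (ii) let \<open>M'\<close> and \<open>N'\<close> be the closures of the images. The operator
  \<open>B : X/N \<rightarrow> Y/N'\<close> induced by \<open>T\<close> is cotauberian since \<open>B Q\<^sub>N = Q\<^sub>N\<^sub>' T\<close>, hence so is \<open>B Q\<^sub>N J\<^sub>M\<close>, which
  is \<open>Q\<^sub>N\<^sub>' J\<^sub>M\<^sub>'\<close> composed with the restriction \<open>M \<rightarrow> M'\<close> of \<open>T\<close>.\<close>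

section \<open>Scalars\<close>

lemma scalar_space_simps [simp]:
  "carrier scalar_space = UNIV"
  "x \<otimes>\<^bsub>scalar_space\<^esub> y = x * y"
  "\<one>\<^bsub>scalar_space\<^esub> = 1"
  "\<zero>\<^bsub>scalar_space\<^esub> = 0"
  "x \<oplus>\<^bsub>scalar_space\<^esub> y = x + y"
  "c \<odot>\<^bsub>scalar_space\<^esub> x = c * x"
  "vnorm scalar_space x = norm x"
  by (simp_all add: scalar_space_def)

lemma cring_scalar_space: "cring (scalar_space :: ('k::real_or_complex, 'k) normed_module)"
proof (rule cringI)
  show "abelian_group (scalar_space :: ('k, 'k) normed_module)"
  proof (rule abelian_groupI)
    show "\<exists>y\<in>carrier scalar_space. y \<oplus>\<^bsub>scalar_space\<^esub> x = \<zero>\<^bsub>scalar_space\<^esub>" for x :: 'k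
      by (intro bexI[of _ "- x"]) simp_all
  qed simp_all
  show "comm_monoid (scalar_space :: ('k, 'k) normed_module)"
    by (rule comm_monoidI) simp_all
qed (simp add: distrib_right)

text \<open>The norm is only known to be multiplicative, so this crude bound stands in for |Re z|
  \<le> |z|. After division by \<open>a\<close> it concerns \<open>w = 1 + t i\<close>: its product
  with the conjugate \<open>w'\<close> is 1 + t^2, while \<open>w'\<close> has norm at most 1 + |t|,
  and 1 + |t| \<le> 2 (1 + t^2). Hence \<open>w\<close> has norm at least 1/2.\<close>

lemma abs_le_norm_of_real_add_imaginary:
  fixes i :: "'k::real_or_complex"
  assumes i: "i * i = - 1"
  shows "\<bar>a\<bar> \<le> 2 * norm (of_real a + of_real b * i)"
proof (cases "a = 0")
  case False
  define t where "t = b / a"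
  define w :: 'k where "w = 1 + of_real t * i"
  define w' :: 'k where "w' = 1 - of_real t * i"
  have ni: "norm i = 1"
  proof -
    have "norm i * norm i = 1"
      using arg_cong[OF i, of norm] by (simp add: norm_mult)
    then have "(norm i - 1) * (norm i + 1) = 0"
      by (simp add: algebra_simps)
    then show ?thesis
      using norm_ge_zero[of i] by (simp add: add_eq_0_iff)
  qed
  have "w * w' = 1 - of_real t * of_real t * (i * i)"
    by (simp add: w_def w'_def algebra_simps)
  also have "\<dots> = of_real (1 + t * t)"
    by (simp add: i)
  finally have "norm w * norm w' = norm (of_real (1 + t * t) :: 'k)"
    by (metis norm_mult)
  also have "\<dots> = 1 + t * t"
    by (simp only: norm_of_real) simp
  finally have ww: "norm w * norm w' = 1 + t * t" .
  have w': "norm w' \<le> 1 + \<bar>t\<bar>"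
    using norm_triangle_ineq4[of 1 "of_real t * i"] by (simp add: w'_def norm_mult ni)
  have "1 + \<bar>t\<bar> \<le> 2 * (1 + t * t)"
  proof -
    have "2 * \<bar>t\<bar> \<le> 1 + t * t"
      using sum_squares_bound[of "\<bar>t\<bar>" 1] by (simp add: power2_eq_square)
    then show ?thesis
      using zero_le_square[of t] by (simp only: distrib_left)
  qed
  also have "\<dots> \<le> 2 * (norm w * (1 + \<bar>t\<bar>))"
    using mult_left_mono[OF w', of "norm w"] ww by simp
  finally have "1 * (1 + \<bar>t\<bar>) \<le> (2 * norm w) * (1 + \<bar>t\<bar>)"
    by (simp add: mult.assoc)
  then have "1 \<le> 2 * norm w"
    by (rule mult_right_le_imp_le) simp
  moreover have "of_real a + of_real b * i = of_real a * w"
    using False by (simp add: w_def t_def distrib_left)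
  then have "norm (of_real a + of_real b * i) = \<bar>a\<bar> * norm w"
    by (simp add: norm_mult)
  ultimately show ?thesis
    using mult_left_mono[of 1 "2 * norm w" "\<bar>a\<bar>"] by simp
qed simp

text \<open>Treating the two scalar fields uniformly: \<open>j\<close> is \<open>0\<close> for the reals and the imaginary unit
  otherwise.\<close>

lemma scalar_real_part:
  obtains j :: "'k::real_or_complex" and re :: "'k \<Rightarrow> real" where
    "j = 0 \<or> j * j = - 1"
    "\<And>z w. re (z + w) = re z + re w"
    "\<And>t z. re (of_real t * z) = t * re z"
    "re 1 = 1" "re j = 0"
    "\<And>z. z = of_real (re z) - of_real (re (j * z)) * j"
    "\<And>z. \<bar>re z\<bar> \<le> 2 * norm z"
proof (cases "\<forall>z::'k. \<exists>a. z = a *\<^sub>R 1")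
  case True
  then have "\<forall>z::'k. \<exists>a. z = of_real a"
    by (simp add: of_real_def)
  then obtain re :: "'k \<Rightarrow> real" where re: "\<And>z. z = of_real (re z)"
    by metis
  have eq: "re z = a" if "z = of_real a" for z a
    using re[of z] that by (metis of_real_eq_iff)
  show thesis
  proof (rule that[of 0 re])
    show "re (z + w) = re z + re w" for z w
      by (rule eq) (metis re of_real_add)
    show "re (of_real t * z) = t * re z" for t z
      by (rule eq) (metis re of_real_mult)
    show "\<bar>re z\<bar> \<le> 2 * norm z" for z
      by (subst (2) re) simp
    show "z = of_real (re z) - of_real (re (0 * z)) * 0" for z
      using re by simp
  qed (auto intro: eq)
next
  case False
  then obtain i :: 'k where i: "i * i = - 1" and "\<forall>z. \<exists>a b. z = a *\<^sub>R 1 + b *\<^sub>R i"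
    using real_or_complex by blast
  then have "\<forall>z. \<exists>a b. z = of_real a + of_real b * i"
    by (simp add: of_real_def)
  then obtain re im :: "'k \<Rightarrow> real" where z: "\<And>z. z = of_real (re z) + of_real (im z) * i"
    by metis
  \<comment> \<open>The real part is well defined: two representations of \<open>z\<close> differ by
    a representation of 0, and the norm bound makes the real part of that one vanish.\<close>
  have eq: "re z = a" if "z = of_real a + of_real b * i" for z a b
  proof -
    have "of_real (re z - a) + of_real (im z - b) * i = z - z"
      using z[of z] that by (simp add: algebra_simps)
    then show ?thesis
      using abs_le_norm_of_real_add_imaginary[OF i, of "re z - a" "im z - b"] by simp
  qed
  show thesis
  proof (rule that[of i re])
    show "re (z + w) = re z + re w" for z w
    proof (rule eq)
      show "z + w = of_real (re z + re w) + of_real (im z + im w) * i"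
        using z[of z] z[of w] by (simp add: algebra_simps)
    qed
    show "re (of_real t * z) = t * re z" for t z
    proof (rule eq)
      show "of_real t * z = of_real (t * re z) + of_real (t * im z) * i"
        by (subst z[of z]) (simp add: algebra_simps)
    qed
    show "re 1 = 1"
      by (rule eq[of _ _ 0]) simp
    show "re i = 0"
      by (rule eq[of _ _ 1]) simp
    show "\<bar>re z\<bar> \<le> 2 * norm z" for z
      using abs_le_norm_of_real_add_imaginary[OF i, of "re z" "im z"] z[of z] by simp
    \<comment> \<open>Multiplication by \<open>i\<close> moves the imaginary part, with its sign
      changed, into the real part, so \<open>re\<close> alone recovers the scalar.\<close>
    show "z = of_real (re z) - of_real (re (i * z)) * i" for z
    proof -
      have "i * z = of_real (re z) * i + of_real (im z) * (i * i)"
        by (subst z) (simp add: algebra_simps)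
      then have "re (i * z) = - im z"
        by (intro eq[of _ _ "re z"]) (simp add: i)
      then show ?thesis
        using z[of z] by simp
    qed
  qed (use i in auto)
qed


section \<open>Normed spaces and bounded operators\<close>

context normed_space
begin

lemma smult_in_carrier [simp]: "x \<in> carrier X \<Longrightarrow> c \<odot> x \<in> carrier X"
  using smult_closed[of c x] by simp

lemma smult_add_left: "x \<in> carrier X \<Longrightarrow> (c + d) \<odot> x = c \<odot> x \<oplus> d \<odot> x"
  using smult_l_distr[of c d x] by simp

lemma smult_add_right: "x \<in> carrier X \<Longrightarrow> y \<in> carrier X \<Longrightarrow> c \<odot> (x \<oplus> y) = c \<odot> x \<oplus> c \<odot> y"
  using smult_r_distr[of c x y] by simp

lemma smult_smult: "x \<in> carrier X \<Longrightarrow> c \<odot> (d \<odot> x) = (c * d) \<odot> x"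
  using smult_assoc1[of c d x] by simp

lemma smult_1 [simp]: "x \<in> carrier X \<Longrightarrow> 1 \<odot> x = x"
  using smult_one[of x] by simp

lemma smult_0 [simp]: "x \<in> carrier X \<Longrightarrow> 0 \<odot> x = \<zero>"
  using smult_l_null[of x] by simp

lemma smult_zero [simp]: "c \<odot> \<zero> = \<zero>"
  using smult_r_null[of c] by simp

lemma minus_eq_smult: "x \<in> carrier X \<Longrightarrow> \<ominus> x = (- 1) \<odot> x"
  using smult_add_left[of x "- 1" 1] M.minus_equality[of "(- 1) \<odot> x" x] by simp

lemma diff_eq_smult: "x \<in> carrier X \<Longrightarrow> y \<in> carrier X \<Longrightarrow> x \<ominus> y = x \<oplus> (- 1) \<odot> y"
  by (simp add: a_minus_def minus_eq_smult)

lemma vnorm_zero [simp]: "vnorm X \<zero> = 0"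
  by (simp add: vnorm_eq_0_iff)

lemma vnorm_minus: "x \<in> carrier X \<Longrightarrow> vnorm X (\<ominus> x) = vnorm X x"
  by (simp add: minus_eq_smult vnorm_smult)

lemma right_minus_eq: "x \<in> carrier X \<Longrightarrow> y \<in> carrier X \<Longrightarrow> x \<ominus> y = \<zero> \<longleftrightarrow> x = y"
  using M.add.inv_solve_right[of \<zero> x y] by (auto simp: a_minus_def M.r_neg)

lemma Metric_space: "Metric_space (carrier X) (vdist X)"
proof
  show "0 \<le> vdist X x y" for x y
    by (simp add: vdist_def vnorm_nonneg)
  show "vdist X x y = vdist X y x" for x y
    using vnorm_minus[of "x \<ominus> y"] by (auto simp: vdist_def a_minus_def M.minus_add M.a_comm)
  show "vdist X x y = 0 \<longleftrightarrow> x = y" if "x \<in> carrier X" "y \<in> carrier X" for x y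
    using that right_minus_eq[of x y] by (simp add: vdist_def vnorm_eq_0_iff)
  show "vdist X x z \<le> vdist X x y + vdist X y z"
    if "x \<in> carrier X" "y \<in> carrier X" "z \<in> carrier X" for x y z
  proof -
    have "x \<ominus> z = (x \<ominus> y) \<oplus> (y \<ominus> z)"
      using that by (simp add: a_minus_def M.a_assoc M.r_neg1)
    then show ?thesis
      using that vnorm_triangle[of "x \<ominus> y" "y \<ominus> z"] by (simp add: vdist_def)
  qed
qed

section \<open>Closures and closed subspaces in terms of the norm\<close>

lemma closure_of_eq:
  assumes "S \<subseteq> carrier X"
  shows "norm_topology X closure_of S = {x \<in> carrier X. \<forall>e>0. \<exists>y\<in>S. vnorm X (x \<ominus> y) < e}"
proof -
  interpret d: Metric_space "carrier X" "vdist X" by (rule Metric_space)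
  show ?thesis
    using assms unfolding d.metric_closure_of by (fastforce simp: vdist_def subset_iff)
qed

lemma subset_closure: "S \<subseteq> carrier X \<Longrightarrow> S \<subseteq> norm_topology X closure_of S"
  using Metric_space by (simp add: closure_of_subset Metric_space.topspace_mtopology)

text \<open>A set is closed iff it contains its closure, and the closure is described by
  approximation in norm. In this form closedness is used for quotient norms and checked for
  preimages.\<close>

lemma closed_subspace_iff:
  "closed_subspace X M \<longleftrightarrow> submodule M scalar_space X \<and>
     (\<forall>x\<in>carrier X. (\<forall>e>0. \<exists>y\<in>M. vnorm X (x \<ominus> y) < e) \<longrightarrow> x \<in> M)"
proof (cases "submodule M scalar_space X")
  case True
  then have M: "M \<subseteq> carrier X"
    by (rule submoduleE)
  interpret d: Metric_space "carrier X" "vdist X" by (rule Metric_space)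
  have "closedin (norm_topology X) M \<longleftrightarrow> norm_topology X closure_of M \<subseteq> M"
    using M by (metis closure_of_subset_eq d.topspace_mtopology)
  then show ?thesis
    using True by (auto simp: closed_subspace_def closure_of_eq[OF M])
qed (simp add: closed_subspace_def)

text \<open>Negation is multiplication by -1, so closure under scalars covers closure under additive
  inverses.\<close>

lemma submoduleI':
  assumes "M \<subseteq> carrier X" "\<zero> \<in> M" "\<And>x y. x \<in> M \<Longrightarrow> y \<in> M \<Longrightarrow> x \<oplus> y \<in> M"
    and smult: "\<And>c x. x \<in> M \<Longrightarrow> c \<odot> x \<in> M"
  shows "submodule M scalar_space X"
proof (rule submoduleI)
  show "\<ominus> x \<in> M" if "x \<in> M" for x
    using that smult[of x "- 1"] assms(1) by (auto simp: minus_eq_smult)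
qed (use assms in auto)

lemma submodule_zero: "submodule M scalar_space X \<Longrightarrow> \<zero> \<in> M"
proof -
  assume M: "submodule M scalar_space X"
  then obtain x where "x \<in> M" using submoduleE(2) by blast
  then show ?thesis
    using submoduleE(1)[OF M] submoduleE(4)[OF M, of 0 x] by (simp add: subset_iff)
qed

end

section \<open>Bounded operators\<close>

lemma bounded_operatorD:
  assumes "bounded_operator X Y S"
  shows "x \<in> carrier X \<Longrightarrow> S x \<in> carrier Y"
    and "x \<in> carrier X \<Longrightarrow> y \<in> carrier X \<Longrightarrow> S (x \<oplus>\<^bsub>X\<^esub> y) = S x \<oplus>\<^bsub>Y\<^esub> S y"
    and "x \<in> carrier X \<Longrightarrow> S (c \<odot>\<^bsub>X\<^esub> x) = c \<odot>\<^bsub>Y\<^esub> S x"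
  using assms by (auto simp: bounded_operator_def)

lemma bounded_operatorI:
  assumes "\<And>x. x \<in> carrier X \<Longrightarrow> S x \<in> carrier Y"
    and "\<And>x y. x \<in> carrier X \<Longrightarrow> y \<in> carrier X \<Longrightarrow> S (x \<oplus>\<^bsub>X\<^esub> y) = S x \<oplus>\<^bsub>Y\<^esub> S y"
    and "\<And>c x. x \<in> carrier X \<Longrightarrow> S (c \<odot>\<^bsub>X\<^esub> x) = c \<odot>\<^bsub>Y\<^esub> S x"
    and "\<And>x. x \<in> carrier X \<Longrightarrow> vnorm Y (S x) \<le> C * vnorm X x"
  shows "bounded_operator X Y S"
  unfolding bounded_operator_def by (intro conjI exI[of _ C]) (use assms in auto)

context normed_space
begin

text \<open>The constant in the definition may have any sign. Its maximum with 0 is also a bound,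
  and inequalities may then be multiplied by it.\<close>

lemma bounded_operator_bound:
  assumes "bounded_operator X Y S"
  obtains C where "0 \<le> C" "\<And>x. x \<in> carrier X \<Longrightarrow> vnorm Y (S x) \<le> C * vnorm X x"
proof -
  from assms obtain C where C: "\<And>x. x \<in> carrier X \<Longrightarrow> vnorm Y (S x) \<le> C * vnorm X x"
    unfolding bounded_operator_def by blast
  have "vnorm Y (S x) \<le> max C 0 * vnorm X x" if "x \<in> carrier X" for x
    using C[OF that] mult_right_mono[of C "max C 0" "vnorm X x"] vnorm_nonneg[OF that] by simp
  then show ?thesis
    by (intro that[of "max C 0"]) simp_all
qed

lemma bounded_operator_cong:
  assumes "bounded_operator X Y S" "\<And>x. x \<in> carrier X \<Longrightarrow> S' x = S x"
  shows "bounded_operator X Y S'"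
proof -
  obtain C where "\<And>x. x \<in> carrier X \<Longrightarrow> vnorm Y (S x) \<le> C * vnorm X x"
    using bounded_operator_bound[OF assms(1)] by blast
  then show ?thesis
    by (intro bounded_operatorI[where C = C]) (simp_all add: assms(2) bounded_operatorD[OF assms(1)])
qed

lemma bounded_operator_comp:
  assumes S: "bounded_operator X Y S" and R: "bounded_operator Y Z R" and Y: "normed_space Y"
  shows "bounded_operator X Z (\<lambda>x. R (S x))"
proof -
  obtain C where C: "\<And>x. x \<in> carrier X \<Longrightarrow> vnorm Y (S x) \<le> C * vnorm X x"
    using bounded_operator_bound[OF S] by blast
  obtain D where D: "0 \<le> D" "\<And>y. y \<in> carrier Y \<Longrightarrow> vnorm Z (R y) \<le> D * vnorm Y y"
    using normed_space.bounded_operator_bound[OF Y R] by blast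
  show ?thesis
  proof (rule bounded_operatorI)
    show "vnorm Z (R (S x)) \<le> D * C * vnorm X x" if "x \<in> carrier X" for x
      using D(2)[of "S x"] mult_left_mono[OF C[OF that] D(1)] bounded_operatorD(1)[OF S that]
      by (simp add: mult.assoc)
  qed (simp_all add: bounded_operatorD[OF S] bounded_operatorD[OF R])
qed

lemma bounded_operator_zero:
  assumes S: "bounded_operator X Y S" and Y: "normed_space Y"
  shows "S \<zero> = \<zero>\<^bsub>Y\<^esub>"
proof -
  interpret Y: normed_space Y by (rule Y)
  show ?thesis
    using bounded_operatorD(3)[OF S, of \<zero> 0] bounded_operatorD(1)[OF S, of \<zero>] by simp
qed

lemma bounded_operator_diff:
  assumes S: "bounded_operator X Y S" and Y: "normed_space Y" and x: "x \<in> carrier X" "y \<in> carrier X"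
  shows "S (x \<ominus> y) = S x \<ominus>\<^bsub>Y\<^esub> S y"
proof -
  interpret Y: normed_space Y by (rule Y)
  show ?thesis
    using x by (simp add: diff_eq_smult Y.diff_eq_smult bounded_operatorD[OF S])
qed

end


section \<open>The Hahn-Banach theorem\<close>

context normed_space
begin

text \<open>Linear functionals dominated by \<open>C\<close> times the norm on a real subspace are represented by their
  graphs; the bound forces a real subspace of \<open>X \<times> \<real>\<close> to be single-valued.\<close>

definition dominated_graph :: "real \<Rightarrow> ('a \<times> real) set \<Rightarrow> bool" where
  "dominated_graph C G \<longleftrightarrow>
     (\<forall>x r. (x, r) \<in> G \<longrightarrow> x \<in> carrier X \<and> r \<le> C * vnorm X x) \<and>
     (\<zero>, 0) \<in> G \<and>
     (\<forall>x r y s. (x, r) \<in> G \<longrightarrow> (y, s) \<in> G \<longrightarrow> (x \<oplus> y, r + s) \<in> G) \<and>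
     (\<forall>t x r. (x, r) \<in> G \<longrightarrow> (of_real t \<odot> x, t * r) \<in> G)"

lemma dominated_graphD:
  assumes "dominated_graph C G"
  shows "(x, r) \<in> G \<Longrightarrow> x \<in> carrier X"
    and "(x, r) \<in> G \<Longrightarrow> r \<le> C * vnorm X x"
    and "(\<zero>, 0) \<in> G"
    and "(x, r) \<in> G \<Longrightarrow> (y, s) \<in> G \<Longrightarrow> (x \<oplus> y, r + s) \<in> G"
    and "(x, r) \<in> G \<Longrightarrow> (of_real t \<odot> x, t * r) \<in> G"
  using assms by (auto simp: dominated_graph_def)

text \<open>The one-dimensional step of Hahn-Banach. The value \<open>c\<close> at \<open>z\<close>
  has to lie between all r - C |x - z| and all C |y + z| - s for (x, r) and (y, s) in
  \<open>G\<close>. If \<open>z\<close> is already in the domain, these bounds leave only its old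
  value, so no case distinction is made.\<close>

lemma dominated_graph_extend:
  assumes G: "dominated_graph C G" and C: "0 \<le> C" and z: "z \<in> carrier X"
  obtains c where "dominated_graph C {(x \<oplus> of_real t \<odot> z, r + t * c) |x r t. (x, r) \<in> G}"
proof -
  note [simp] = z dominated_graphD(1)[OF G]
  define L where "L = {r - C * vnorm X (x \<oplus> (- 1) \<odot> z) |x r. (x, r) \<in> G}"
  define c where "c = Sup L"
  \<comment> \<open>Every lower bound is below every upper bound, by the triangle inequality for x +
    y = (x - z) + (y + z).\<close>
  have sep: "r - C * vnorm X (x \<oplus> (- 1) \<odot> z) \<le> C * vnorm X (y \<oplus> z) - s"
    if xr: "(x, r) \<in> G" and ys: "(y, s) \<in> G" for x r y s
  proof -
    have car: "x \<in> carrier X" "y \<in> carrier X"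
      using xr ys by simp_all
    have "(x \<oplus> (- 1) \<odot> z) \<oplus> (y \<oplus> z) = (x \<oplus> y) \<oplus> ((- 1) \<odot> z \<oplus> 1 \<odot> z)"
      using car by (simp add: M.a_ac)
    also have "\<dots> = x \<oplus> y"
      using car smult_add_left[of z "- 1" 1] by simp
    finally have "vnorm X (x \<oplus> y) \<le> vnorm X (x \<oplus> (- 1) \<odot> z) + vnorm X (y \<oplus> z)"
      using car vnorm_triangle[of "x \<oplus> (- 1) \<odot> z" "y \<oplus> z"] by simp
    then have "C * vnorm X (x \<oplus> y) \<le> C * vnorm X (x \<oplus> (- 1) \<odot> z) + C * vnorm X (y \<oplus> z)"
      using mult_left_mono[OF _ C] by (simp add: distrib_left [symmetric])
    moreover have "r + s \<le> C * vnorm X (x \<oplus> y)"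
      using dominated_graphD(2,4)[OF G] xr ys by blast
    ultimately show ?thesis by simp
  qed
  have bdd: "bdd_above L"
    unfolding bdd_above_def L_def using sep[OF _ dominated_graphD(3)[OF G]] by blast
  have ne: "L \<noteq> {}"
    using dominated_graphD(3)[OF G] by (auto simp: L_def)
  have lower: "r - C * vnorm X (x \<oplus> (- 1) \<odot> z) \<le> c" if "(x, r) \<in> G" for x r
    unfolding c_def by (rule cSup_upper[OF _ bdd]) (use that in \<open>auto simp: L_def\<close>)
  have upper: "c \<le> C * vnorm X (y \<oplus> z) - s" if "(y, s) \<in> G" for y s
    unfolding c_def by (rule cSup_least[OF ne]) (use sep that in \<open>auto simp: L_def\<close>)
  \<comment> \<open>For nonzero \<open>t\<close>, division by |t| leaves the coefficients 1 and -1
    of \<open>z\<close>; these are the upper bound at x / t and the lower bound at x / (-t).\<close>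
  have dom: "r + t * c \<le> C * vnorm X (x \<oplus> of_real t \<odot> z)" if xr: "(x, r) \<in> G" for x r t
  proof -
    have x: "x \<in> carrier X" using xr by simp
    consider "t = 0" | "t > 0" | "t < 0" by linarith
    then show ?thesis
    proof cases
      case 1
      then show ?thesis
        using dominated_graphD(2)[OF G xr] x by simp
    next
      case 2
      have "of_real t \<odot> (of_real (1 / t) \<odot> x \<oplus> z) = x \<oplus> of_real t \<odot> z"
        using 2 x by (simp add: smult_add_right smult_smult)
      then have eq: "vnorm X (x \<oplus> of_real t \<odot> z) = t * vnorm X (of_real (1 / t) \<odot> x \<oplus> z)"
        using 2 x vnorm_smult[of "of_real (1 / t) \<odot> x \<oplus> z" "of_real t"] by simp
      have "c \<le> C * vnorm X (of_real (1 / t) \<odot> x \<oplus> z) - 1 / t * r"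
        by (rule upper[OF dominated_graphD(5)[OF G xr]])
      from mult_left_mono[OF this, of t] show ?thesis
        using 2 by (simp add: eq algebra_simps)
    next
      case 3
      have "of_real (- t) \<odot> (of_real (- 1 / t) \<odot> x \<oplus> (- 1) \<odot> z) = x \<oplus> of_real t \<odot> z"
        using 3 x by (simp add: smult_add_right smult_smult)
      then have eq: "vnorm X (x \<oplus> of_real t \<odot> z) = - t * vnorm X (of_real (- 1 / t) \<odot> x \<oplus> (- 1) \<odot> z)"
        using 3 x vnorm_smult[of "of_real (- 1 / t) \<odot> x \<oplus> (- 1) \<odot> z" "of_real (- t)"] by simp
      have "- 1 / t * r - C * vnorm X (of_real (- 1 / t) \<odot> x \<oplus> (- 1) \<odot> z) \<le> c"
        by (rule lower[OF dominated_graphD(5)[OF G xr]])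
      from mult_left_mono[OF this, of "- t"] show ?thesis
        using 3 by (simp add: eq algebra_simps)
    qed
  qed
  let ?H = "{(x \<oplus> of_real t \<odot> z, r + t * c) |x r t. (x, r) \<in> G}"
  have "dominated_graph C ?H"
    unfolding dominated_graph_def
  proof (intro conjI allI impI)
    fix w q assume "(w, q) \<in> ?H"
    then show "w \<in> carrier X" "q \<le> C * vnorm X w"
      using dom by auto
  next
    show "(\<zero>, 0) \<in> ?H"
      using dominated_graphD(3)[OF G] by (auto intro!: exI[of _ \<zero>] exI[of _ "0::real"])
  next
    fix w q w' q' assume "(w, q) \<in> ?H" "(w', q') \<in> ?H"
    then obtain x r t x' r' t' where *: "w = x \<oplus> of_real t \<odot> z" "q = r + t * c" "(x, r) \<in> G"
      "w' = x' \<oplus> of_real t' \<odot> z" "q' = r' + t' * c" "(x', r') \<in> G" by blast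
    then have "w \<oplus> w' = (x \<oplus> x') \<oplus> of_real (t + t') \<odot> z" "q + q' = (r + r') + (t + t') * c"
      by (simp_all add: smult_add_left M.a_ac algebra_simps)
    then show "(w \<oplus> w', q + q') \<in> ?H"
      using dominated_graphD(4)[OF G *(3,6)] by blast
  next
    fix s w q assume "(w, q) \<in> ?H"
    then obtain x r t where *: "w = x \<oplus> of_real t \<odot> z" "q = r + t * c" "(x, r) \<in> G" by blast
    then have "of_real s \<odot> w = of_real s \<odot> x \<oplus> of_real (s * t) \<odot> z" "s * q = s * r + (s * t) * c"
      by (simp_all add: smult_add_right smult_smult algebra_simps)
    then show "(of_real s \<odot> w, s * q) \<in> ?H"
      using dominated_graphD(5)[OF G *(3), of s] by blast
  qed
  then show ?thesis by (rule that)
qed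

text \<open>Zorn's lemma gives a maximal dominated graph above \<open>G0\<close>: any two points in
  the union of a chain lie in a common member, so unions of chains are again dominated. By the
  one-dimensional step a maximal graph has full domain.\<close>

lemma real_hahn_banach:
  assumes G0: "dominated_graph C G0" and C: "0 \<le> C"
  obtains u where "\<And>x r. (x, r) \<in> G0 \<Longrightarrow> u x = r"
    "\<And>x y. x \<in> carrier X \<Longrightarrow> y \<in> carrier X \<Longrightarrow> u (x \<oplus> y) = u x + u y"
    "\<And>t x. x \<in> carrier X \<Longrightarrow> u (of_real t \<odot> x) = t * u x"
    "\<And>x. x \<in> carrier X \<Longrightarrow> \<bar>u x\<bar> \<le> C * vnorm X x"
proof -
  let ?A = "{G. dominated_graph C G \<and> G0 \<subseteq> G}"
  have "\<exists>G\<in>?A. \<forall>H\<in>?A. G \<subseteq> H \<longrightarrow> H = G"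
  proof (rule subset_Zorn_nonempty)
    show "?A \<noteq> {}" using G0 by blast
  next
    fix \<C> assume ne: "\<C> \<noteq> {}" and ch: "subset.chain ?A \<C>"
    have sub: "\<And>G. G \<in> \<C> \<Longrightarrow> dominated_graph C G \<and> G0 \<subseteq> G"
      using ch by (auto simp: subset.chain_def)
    have "dominated_graph C (\<Union>\<C>)"
      unfolding dominated_graph_def
    proof (intro conjI allI impI)
      fix x r assume "(x, r) \<in> \<Union>\<C>"
      then show "x \<in> carrier X" "r \<le> C * vnorm X x"
        using sub dominated_graphD by blast+
    next
      show "(\<zero>, 0) \<in> \<Union>\<C>"
        using ne sub dominated_graphD(3) by blast
    next
      fix x r y s assume "(x, r) \<in> \<Union>\<C>" "(y, s) \<in> \<Union>\<C>"
      then obtain G H where GH: "G \<in> \<C>" "H \<in> \<C>" "(x, r) \<in> G" "(y, s) \<in> H" by blast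
      then have "G \<subseteq> H \<or> H \<subseteq> G"
        using ch by (auto simp: subset_chain_def)
      then show "(x \<oplus> y, r + s) \<in> \<Union>\<C>"
        using GH sub dominated_graphD(4) by (metis UnionI subsetD)
    next
      fix t x r assume "(x, r) \<in> \<Union>\<C>"
      then show "(of_real t \<odot> x, t * r) \<in> \<Union>\<C>"
        using sub dominated_graphD(5) by blast
    qed
    then show "\<Union>\<C> \<in> ?A"
      using ne sub by blast
  qed
  then obtain G where G: "dominated_graph C G" "G0 \<subseteq> G"
    and max: "\<And>H. dominated_graph C H \<Longrightarrow> G \<subseteq> H \<Longrightarrow> H = G" by (metis (no_types, lifting) mem_Collect_eq order_trans)
  have total: "\<exists>r. (z, r) \<in> G" if z: "z \<in> carrier X" for z
  proof -
    obtain c where c: "dominated_graph C {(x \<oplus> of_real t \<odot> z, r + t * c) |x r t. (x, r) \<in> G}" (is "dominated_graph C ?H")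
      using dominated_graph_extend[OF G(1) C z] by blast
    have "(x, r) \<in> ?H" if "(x, r) \<in> G" for x r
    proof -
      have "(x, r) = (x \<oplus> of_real 0 \<odot> z, r + 0 * c)"
        using dominated_graphD(1)[OF G(1) that] z by simp
      then show ?thesis
        using that by blast
    qed
    \<comment> \<open>By maximality the extension adds nothing, although it contains a point over
      \<open>z\<close>.\<close>
    then have "?H = G"
      by (intro max[OF c]) auto
    moreover have "(z, c) \<in> ?H"
    proof -
      have "(z, c) = (\<zero> \<oplus> of_real 1 \<odot> z, 0 + 1 * c)"
        using z by simp
      then show ?thesis
        using dominated_graphD(3)[OF G(1)] by blast
    qed
    ultimately show ?thesis by blast
  qed
  \<comment> \<open>The graph also contains the point with value -r over the zero vector, and
    domination there bounds both r and -r by 0.\<close>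
  have zero: "r = 0" if "(\<zero>, r) \<in> G" for r
    using dominated_graphD(2)[OF G(1) that] dominated_graphD(2)[OF G(1) dominated_graphD(5)[OF G(1) that, of "- 1"]]
    by simp
  have unique: "r = s" if r: "(x, r) \<in> G" and s: "(x, s) \<in> G" for x r s
  proof -
    have "x \<oplus> of_real (- 1) \<odot> x = \<zero>"
      using smult_add_left[of x 1 "- 1"] dominated_graphD(1)[OF G(1) r] by simp
    then have "(\<zero>, r + - 1 * s) \<in> G"
      using dominated_graphD(4)[OF G(1) r dominated_graphD(5)[OF G(1) s, of "- 1"]] by simp
    then show ?thesis using zero by fastforce
  qed
  obtain u where u: "\<And>x. x \<in> carrier X \<Longrightarrow> (x, u x) \<in> G"
    using total by metis
  show thesis
  proof (rule that[of u])
    show "u x = r" if "(x, r) \<in> G0" for x r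
      using that G(2) u unique dominated_graphD(1)[OF G0] by blast
    show "u (x \<oplus> y) = u x + u y" if "x \<in> carrier X" "y \<in> carrier X" for x y
      using that u unique dominated_graphD(4)[OF G(1)] by (meson M.a_closed)
    show "u (of_real t \<odot> x) = t * u x" if "x \<in> carrier X" for t x
      using that u unique dominated_graphD(5)[OF G(1)] by (meson smult_in_carrier)
    show "\<bar>u x\<bar> \<le> C * vnorm X x" if "x \<in> carrier X" for x
      using dominated_graphD(2)[OF G(1) u[OF that]]
        dominated_graphD(2)[OF G(1) dominated_graphD(5)[OF G(1) u[OF that], of "- 1"]] that
      by (simp add: vnorm_smult)
  qed
qed

text \<open>A functional is recovered from its real part \<open>u\<close> as \<open>u x - u (j x) j\<close>.\<close>

lemma real_functional_to_functional:
  fixes j :: 'k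
  assumes j: "j = 0 \<or> j * j = - 1"
    and re: "\<And>z w. re (z + w) = re z + re w" "\<And>t z. re (of_real t * z) = t * re z" "re 1 = 1" "re j = 0"
      "\<And>z. z = of_real (re z) - of_real (re (j * z)) * j"
    and u: "\<And>x y. x \<in> carrier X \<Longrightarrow> y \<in> carrier X \<Longrightarrow> u (x \<oplus> y) = u x + u y"
      "\<And>t x. x \<in> carrier X \<Longrightarrow> u (of_real t \<odot> x) = t * u x"
      "\<And>x. x \<in> carrier X \<Longrightarrow> \<bar>u x\<bar> \<le> C * vnorm X x"
    and C: "0 \<le> C"
  shows "\<exists>g. bounded_operator X scalar_space g \<and> (\<forall>x\<in>carrier X. re (g x) = u x)"
proof -
  define g where "g x = of_real (u x) - of_real (u (j \<odot> x)) * j" for x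
  have add: "g (x \<oplus> y) = g x + g y" if "x \<in> carrier X" "y \<in> carrier X" for x y
    using that by (simp add: g_def u smult_add_right algebra_simps)
  have real: "g (of_real t \<odot> x) = of_real t * g x" if x: "x \<in> carrier X" for t x
  proof -
    have "j \<odot> (of_real t \<odot> x) = of_real t \<odot> (j \<odot> x)"
      using x by (simp add: smult_smult mult.commute)
    then show ?thesis
      using x by (simp add: g_def u algebra_simps)
  qed
  have imag: "g (j \<odot> x) = j * g x" if x: "x \<in> carrier X" for x
  proof -
    have 0: "u \<zero> = 0"
      using u(2)[of \<zero> 0] by simp
    have 1: "u ((- 1) \<odot> x) = - u x"
      using u(2)[OF x, of "- 1"] by simp
    from j show ?thesis
    proof
      assume "j = 0"
      then show ?thesis using x by (simp add: g_def 0)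
    next
      assume jj: "j * j = - 1"
      have "j * g x = of_real (u x) * j - of_real (u (j \<odot> x)) * (j * j)"
        by (simp add: g_def algebra_simps)
      then show ?thesis using x by (simp add: g_def smult_smult jj 1)
    qed
  qed
  have smult: "g (c \<odot> x) = c * g x" if x: "x \<in> carrier X" for c x
  proof -
    \<comment> \<open>These are the coordinates of \<open>c\<close> with respect to 1 and
      \<open>j\<close>; homogeneity thus reduces to real scalars and to \<open>j\<close>.\<close>
    define a b where "a = re c" and "b = - re (j * c)"
    have c: "c = of_real a + of_real b * j"
      using re(5)[of c] by (simp add: a_def b_def)
    have "c \<odot> x = of_real a \<odot> x \<oplus> of_real b \<odot> (j \<odot> x)"
      using x by (simp add: c smult_add_left smult_smult)
    then have "g (c \<odot> x) = of_real a * g x + of_real b * (j * g x)"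
      using x by (simp add: add real imag)
    then show ?thesis
      by (simp add: c algebra_simps)
  qed
  \<comment> \<open>The two summands come from \<open>u x\<close> and from
    \<open>u (j \<odot> x)\<close>; the constant need not be sharp, as only boundedness is
    claimed.\<close>
  have bound: "norm (g x) \<le> (C + C * norm j * norm j) * vnorm X x" if x: "x \<in> carrier X" for x
  proof -
    have "norm (g x) \<le> \<bar>u x\<bar> + \<bar>u (j \<odot> x)\<bar> * norm j"
      unfolding g_def by (rule order_trans[OF norm_triangle_ineq4]) (simp add: norm_mult)
    also have "\<dots> \<le> C * vnorm X x + C * vnorm X (j \<odot> x) * norm j"
      using x by (intro add_mono mult_right_mono u) simp_all
    finally show ?thesis
      using x by (simp add: vnorm_smult algebra_simps)
  qed
  show ?thesis
  proof (intro exI[of _ g] conjI ballI)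
    show "bounded_operator X scalar_space g"
      by (rule bounded_operatorI[where C = "C + C * norm j * norm j"]) (simp_all add: add smult bound)
    have "re (g x) = re (of_real (u x) * 1 + of_real (- u (j \<odot> x)) * j)" for x
      by (simp add: g_def)
    then show "re (g x) = u x" for x
      by (simp only: re(1-4))
  qed
qed

text \<open>The real part of \<open>f\<close> is extended as a real functional, and a scalar
  functional \<open>g\<close> is rebuilt from the extension. The bound may grow on the way, but
  tauberian properties involve only boundedness of functionals.\<close>

theorem hahn_banach:
  assumes M: "submodule M scalar_space X" and f: "bounded_operator (subspace_of X M) scalar_space f"
  obtains g where "bounded_operator X scalar_space g" "\<And>x. x \<in> M \<Longrightarrow> g x = f x"
proof -
  obtain j re where j: "j = (0::'k) \<or> j * j = - 1"
    and re: "\<And>z w. re (z + w) = re z + re w" "\<And>t z. re (of_real t * z) = t * re z" "re 1 = 1" "re j = 0"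
      "\<And>z::'k. z = of_real (re z) - of_real (re (j * z)) * j"
    and re_bound: "\<And>z. \<bar>re z\<bar> \<le> 2 * norm z"
    by (rule scalar_real_part[where 'k = 'k], rule that)
  note sub = submoduleE[OF M]
  have M_car: "x \<in> carrier X" if "x \<in> M" for x using that sub by blast
  have f': "\<And>x y. x \<in> M \<Longrightarrow> y \<in> M \<Longrightarrow> f (x \<oplus> y) = f x + f y" "\<And>c x. x \<in> M \<Longrightarrow> f (c \<odot> x) = c * f x"
    using bounded_operatorD[OF f] by (simp_all add: subspace_of_def)
  have "\<exists>C. \<forall>x\<in>M. norm (f x) \<le> C * vnorm X x"
    using f by (simp add: bounded_operator_def subspace_of_def)
  then obtain C0 where C0: "\<And>x. x \<in> M \<Longrightarrow> norm (f x) \<le> C0 * vnorm X x"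
    by blast
  \<comment> \<open>The factor 2 is the constant in the estimate of \<open>re\<close> by the
    norm.\<close>
  define C where "C = 2 * max C0 0"
  have "norm (f x) \<le> max C0 0 * vnorm X x" if "x \<in> M" for x
    using C0[OF that] mult_right_mono[of C0 "max C0 0" "vnorm X x"] vnorm_nonneg[OF M_car[OF that]] by simp
  then have f_bound: "re (f x) \<le> C * vnorm X x" if "x \<in> M" for x
    using re_bound[of "f x"] that by (fastforce simp: C_def)
  have f0: "f \<zero> = 0"
    using f'(2)[of \<zero> 0] submodule_zero[OF M] by simp
  have re0: "re 0 = 0"
    using re(1)[of 0 0] by simp
  have C_nonneg: "0 \<le> C" by (simp add: C_def)
  have G: "dominated_graph C ((\<lambda>x. (x, re (f x))) ` M)"
    unfolding dominated_graph_def
    using submodule_zero[OF M] sub(4,5) M_car f_bound by (auto simp: f' f0 re0 re(1,2) image_iff)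
  obtain u where u0: "\<And>x r. (x, r) \<in> (\<lambda>x. (x, re (f x))) ` M \<Longrightarrow> u x = r"
    and u:
    "\<And>x y. x \<in> carrier X \<Longrightarrow> y \<in> carrier X \<Longrightarrow> u (x \<oplus> y) = u x + u y"
    "\<And>t x. x \<in> carrier X \<Longrightarrow> u (of_real t \<odot> x) = t * u x"
    "\<And>x. x \<in> carrier X \<Longrightarrow> \<bar>u x\<bar> \<le> C * vnorm X x"
    by (rule real_hahn_banach[OF G C_nonneg], rule that)
  have uM: "u x = re (f x)" if "x \<in> M" for x
    using that by (intro u0) blast
  obtain g where g: "bounded_operator X scalar_space g" "\<And>x. x \<in> carrier X \<Longrightarrow> re (g x) = u x"
    using real_functional_to_functional[where j = j and re = re and u = u and C = C, OF j re u C_nonneg] by blast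
  have "g x = f x" if x: "x \<in> M" for x
  proof (rule ccontr)
    assume "g x \<noteq> f x"
    \<comment> \<open>So far only the real parts agree on \<open>M\<close>. This factor scales the
      difference of the values to 1, so at the point \<open>c \<odot> x\<close> of \<open>M\<close>
      the real parts would differ by 1.\<close>
    define c where "c = inverse (g x - f x)"
    have cx: "c \<odot> x \<in> M" using x sub(4) by simp
    have "re (c * g x) = re (c * f x)"
      using g(2)[OF M_car[OF cx]] uM[OF cx] bounded_operatorD(3)[OF g(1) M_car[OF x]] x by (simp add: f')
    moreover have "c * g x = c * f x + 1"
      using \<open>g x \<noteq> f x\<close> left_inverse[of "g x - f x"] by (simp add: c_def right_diff_distrib algebra_simps)
    ultimately show False by (simp add: re(1,3))
  qed
  then show ?thesis using g(1) that by blast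
qed

text \<open>On the real line through \<open>z\<close> the functional sending t z to t |z| is
  dominated by the norm. Its extension is the real part of a functional whose value at
  \<open>z\<close> has real part |z| > 0.\<close>

lemma functional_separates:
  assumes z: "z \<in> carrier X" "z \<noteq> \<zero>"
  obtains g where "bounded_operator X scalar_space g" "g z \<noteq> 0"
proof -
  obtain j re where j: "j = (0::'k) \<or> j * j = - 1"
    and re: "\<And>z w. re (z + w) = re z + re w" "\<And>t z. re (of_real t * z) = t * re z" "re 1 = 1" "re j = 0"
      "\<And>z::'k. z = of_real (re z) - of_real (re (j * z)) * j"
    and "\<And>z. \<bar>re z\<bar> \<le> 2 * norm z"
    by (rule scalar_real_part[where 'k = 'k], rule that)
  let ?G = "range (\<lambda>t. (of_real t \<odot> z, t * vnorm X z))"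
  have G: "dominated_graph 1 ?G"
    unfolding dominated_graph_def
  proof (intro conjI allI impI)
    fix x r assume "(x, r) \<in> ?G"
    then show "x \<in> carrier X" "r \<le> 1 * vnorm X x"
      using z by (auto simp: vnorm_smult intro!: mult_right_mono vnorm_nonneg)
  next
    show "(\<zero>, 0) \<in> ?G"
      using z by (auto intro!: range_eqI[of _ _ 0])
  next
    fix x r y s assume "(x, r) \<in> ?G" "(y, s) \<in> ?G"
    then obtain a b where "x = of_real a \<odot> z" "r = a * vnorm X z" "y = of_real b \<odot> z" "s = b * vnorm X z"
      by blast
    then show "(x \<oplus> y, r + s) \<in> ?G"
      using z by (auto intro!: range_eqI[of _ _ "a + b"] simp: smult_add_left algebra_simps)
  next
    fix t x r assume "(x, r) \<in> ?G"
    then obtain a where "x = of_real a \<odot> z" "r = a * vnorm X z" by blast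
    then show "(of_real t \<odot> x, t * r) \<in> ?G"
      using z by (auto intro!: range_eqI[of _ _ "t * a"] simp: smult_smult)
  qed
  obtain u where u: "\<And>x r. (x, r) \<in> ?G \<Longrightarrow> u x = r"
    "\<And>x y. x \<in> carrier X \<Longrightarrow> y \<in> carrier X \<Longrightarrow> u (x \<oplus> y) = u x + u y"
    "\<And>t x. x \<in> carrier X \<Longrightarrow> u (of_real t \<odot> x) = t * u x"
    "\<And>x. x \<in> carrier X \<Longrightarrow> \<bar>u x\<bar> \<le> 1 * vnorm X x"
    by (rule real_hahn_banach[OF G zero_le_one], rule that)
  obtain g where g: "bounded_operator X scalar_space g" "\<And>x. x \<in> carrier X \<Longrightarrow> re (g x) = u x"
    using real_functional_to_functional[where j = j and re = re and u = u and C = 1, OF j re u(2-4) zero_le_one] by blast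
  have "(z, vnorm X z) \<in> ?G"
    using z by (auto intro!: range_eqI[of _ _ 1])
  then have "re (g z) = vnorm X z"
    using u(1) g(2) z by simp
  then have "g z \<noteq> 0"
    using z re(1)[of 0 0] by (auto simp: vnorm_eq_0_iff)
  then show ?thesis using g(1) that by blast
qed

end


section \<open>Subspaces, quotients and duals are normed spaces\<close>

text \<open>Homogeneity is reduced to one inequality: applied to c x and the inverse of c it gives
  the reverse one. For norms defined as infima or suprema this is the direction that is checked
  directly.\<close>

lemma normed_spaceI:
  fixes X :: "('k::real_or_complex, 'a) normed_module" (structure)
  assumes "module scalar_space X"
    and nonneg: "\<And>x. x \<in> carrier X \<Longrightarrow> 0 \<le> vnorm X x"
    and zero: "vnorm X \<zero> = 0"
    and definite: "\<And>x. x \<in> carrier X \<Longrightarrow> vnorm X x = 0 \<Longrightarrow> x = \<zero>"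
    and triangle: "\<And>x y. x \<in> carrier X \<Longrightarrow> y \<in> carrier X \<Longrightarrow> vnorm X (x \<oplus> y) \<le> vnorm X x + vnorm X y"
    and smult_le: "\<And>c x. x \<in> carrier X \<Longrightarrow> vnorm X (c \<odot> x) \<le> norm c * vnorm X x"
  shows "normed_space X"
proof -
  interpret module scalar_space X by fact
  show ?thesis
  proof
    show "vnorm X (c \<odot> x) = norm c * vnorm X x" if x: "x \<in> carrier X" for c x
    proof (cases "c = 0")
      case True
      then show ?thesis using smult_le[OF x, of 0] smult_closed[of 0 x] nonneg[of "c \<odot> x"] x by simp
    next
      case False
      have cx: "c \<odot> x \<in> carrier X" using x by simp
      have "inverse c \<odot> (c \<odot> x) = x"
        using smult_assoc1[of "inverse c" c x] smult_one[of x] x False by simp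
      then have "vnorm X x \<le> inverse (norm c) * vnorm X (c \<odot> x)"
        using smult_le[OF cx, of "inverse c"] by (simp add: norm_inverse)
      then have "norm c * vnorm X x \<le> vnorm X (c \<odot> x)"
        using False by (simp add: field_simps)
      then show ?thesis using smult_le[OF x, of c] by simp
    qed
  qed (use nonneg zero definite triangle in auto)
qed

lemma subspace_of_simps [simp]:
  "carrier (subspace_of Z M) = M"
  "add (subspace_of Z M) = add Z"
  "smult (subspace_of Z M) = smult Z"
  "\<zero>\<^bsub>subspace_of Z M\<^esub> = \<zero>\<^bsub>Z\<^esub>"
  "vnorm (subspace_of Z M) = vnorm Z"
  by (simp_all add: subspace_of_def)

context normed_space
begin

lemma normed_space_subspace:
  assumes M: "submodule M scalar_space X"
  shows "normed_space (subspace_of X M)"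
proof -
  have "module scalar_space (subspace_of X M)"
    unfolding subspace_of_def by (rule submodule.submodule_is_module[OF M module_axioms])
  then show ?thesis
    by (rule normed_spaceI)
      (use submoduleE(1)[OF M] in \<open>auto simp: vnorm_nonneg vnorm_eq_0_iff vnorm_triangle vnorm_smult subset_iff\<close>)
qed

lemma bounded_operator_inclusion:
  assumes M: "submodule M scalar_space X"
  shows "bounded_operator (subspace_of X M) X (inclusion_operator M)"
  using submoduleE(1,4,5)[OF M]
  by (intro bounded_operatorI[where C = 1]) (auto simp: inclusion_operator_def)

end

section \<open>Quotients by closed subspaces\<close>

lemma quotient_space_simps:
  "carrier (quotient_space Z N) = a_rcosets\<^bsub>Z\<^esub> N"
  "add (quotient_space Z N) = set_add Z"
  "smult (quotient_space Z N) = (\<lambda>c A. \<Union>z\<in>A. N +>\<^bsub>Z\<^esub> (c \<odot>\<^bsub>Z\<^esub> z))"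
  "\<zero>\<^bsub>quotient_space Z N\<^esub> = N"
  "vnorm (quotient_space Z N) = (\<lambda>A. INF z\<in>A. vnorm Z z)"
  by (simp_all add: quotient_space_def)

text \<open>Closedness makes the infimum over a coset vanish only at the zero coset. The locale is
  instantiated for both members of a pair, giving inclusions as well as quotient maps.\<close>

locale closed_subspace_quotient = normed_space +
  fixes N
  assumes closed_N: "closed_subspace X N"
begin

lemma submodule_N: "submodule N scalar_space X"
  using closed_N by (simp add: closed_subspace_def)

sublocale N: abelian_subgroup N X
  by (intro abelian_subgroupI3 additive_subgroupI M.abelian_group_axioms submodule.axioms(1)[OF submodule_N])

lemma N_subset: "N \<subseteq> carrier X"
  by (rule N.a_subset)

lemma coset_in_quotient [simp]: "x \<in> carrier X \<Longrightarrow> N +> x \<in> carrier (quotient_space X N)"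
  by (auto simp: quotient_space_simps A_RCOSETS_def')

lemma quotient_cases:
  assumes "A \<in> carrier (quotient_space X N)"
  obtains x where "x \<in> carrier X" "A = N +> x"
  using assms by (auto simp: quotient_space_simps A_RCOSETS_def')

lemma mem_coset_iff: "x \<in> carrier X \<Longrightarrow> z \<in> N +> x \<longleftrightarrow> z \<in> carrier X \<and> z \<ominus> x \<in> N"
proof (intro iffI conjI)
  assume x: "x \<in> carrier X"
  { assume "z \<in> N +> x"
    then obtain h where "h \<in> N" "z = h \<oplus> x" by (auto simp: a_r_coset_def')
    then show "z \<in> carrier X" "z \<ominus> x \<in> N"
      using x N_subset by (auto simp: a_minus_def M.a_assoc M.r_neg subset_iff) }
  assume z: "z \<in> carrier X \<and> z \<ominus> x \<in> N"
  then have "z = (z \<ominus> x) \<oplus> x"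
    using x by (simp add: a_minus_def M.a_assoc M.l_neg)
  then show "z \<in> N +> x"
    using z by (auto simp: a_r_coset_def')
qed

lemma coset_eq_iff:
  assumes "x \<in> carrier X" "y \<in> carrier X"
  shows "N +> x = N +> y \<longleftrightarrow> x \<ominus> y \<in> N"
proof
  show "x \<ominus> y \<in> N" if "N +> x = N +> y"
    using N.a_rcos_self[OF assms(1)] mem_coset_iff[OF assms(2), of x] that by simp
  show "N +> x = N +> y" if "x \<ominus> y \<in> N"
  proof -
    have "x \<in> N +> y"
      using mem_coset_iff[OF assms(2)] assms(1) that by blast
    then show ?thesis
      by (rule M.a_repr_independence[OF _ assms(2) N.a_subgroup, symmetric])
  qed
qed

lemma coset_add [simp]:
  "x \<in> carrier X \<Longrightarrow> y \<in> carrier X \<Longrightarrow> (N +> x) \<oplus>\<^bsub>quotient_space X N\<^esub> (N +> y) = N +> (x \<oplus> y)"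
  by (simp add: quotient_space_simps N.a_rcos_sum)

text \<open>For representatives z and x of one coset, c z - c x = c (z - x) lies in
  \<open>N\<close>. The union in the definition is therefore over a constant family.\<close>

lemma coset_smult [simp]:
  assumes x: "x \<in> carrier X"
  shows "c \<odot>\<^bsub>quotient_space X N\<^esub> (N +> x) = N +> (c \<odot> x)"
proof -
  have "N +> (c \<odot> z) = N +> (c \<odot> x)" if "z \<in> N +> x" for z
  proof -
    have z: "z \<in> carrier X" "z \<ominus> x \<in> N" using that x by (simp_all add: mem_coset_iff)
    have "(c \<odot> z) \<ominus> (c \<odot> x) = c \<odot> (z \<ominus> x)"
      using x z by (simp add: diff_eq_smult smult_add_right smult_smult)
    then show ?thesis
      using x z submoduleE(4)[OF submodule_N, of c "z \<ominus> x"] by (simp add: coset_eq_iff)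
  qed
  then show ?thesis
    unfolding quotient_space_simps by (intro UN_constant_eq[OF N.a_rcos_self[OF x]] ballI)
qed

lemma coset_zero: "N +> \<zero> = N"
  by (simp add: N_subset)

lemma coset_norm_le:
  assumes "x \<in> carrier X" "z \<in> N +> x"
  shows "vnorm (quotient_space X N) (N +> x) \<le> vnorm X z"
proof -
  have "bdd_below (vnorm X ` (N +> x))"
    using assms(1) by (auto simp: bdd_below_def mem_coset_iff intro!: exI[of _ 0] vnorm_nonneg)
  then show ?thesis
    using assms(2) by (simp add: quotient_space_simps cINF_lower)
qed

lemma coset_norm_greatest:
  assumes "x \<in> carrier X" "\<And>z. z \<in> N +> x \<Longrightarrow> b \<le> vnorm X z"
  shows "b \<le> vnorm (quotient_space X N) (N +> x)"
  using assms N.a_rcos_self by (auto simp: quotient_space_simps intro!: cINF_greatest)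

lemma coset_norm_approx:
  assumes "x \<in> carrier X" "e > 0"
  obtains z where "z \<in> N +> x" "vnorm X z < vnorm (quotient_space X N) (N +> x) + e"
  using coset_norm_greatest[OF assms(1), of "vnorm (quotient_space X N) (N +> x) + e"] assms(2)
  by (metis less_add_same_cancel1 not_le)

lemma module_quotient: "module scalar_space (quotient_space X N)"
proof (rule moduleI)
  show "abelian_group (quotient_space X N)"
  proof (rule abelian_groupI)
    fix A assume "A \<in> carrier (quotient_space X N)"
    then obtain x where x: "x \<in> carrier X" "A = N +> x" by (rule quotient_cases)
    show "\<zero>\<^bsub>quotient_space X N\<^esub> \<oplus>\<^bsub>quotient_space X N\<^esub> A = A"
      using x coset_add[of \<zero> x] by (simp add: coset_zero quotient_space_simps(4))
    show "\<exists>B\<in>carrier (quotient_space X N). B \<oplus>\<^bsub>quotient_space X N\<^esub> A = \<zero>\<^bsub>quotient_space X N\<^esub>"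
      using x by (intro bexI[of _ "N +> (\<ominus> x)"]) (simp_all add: coset_zero quotient_space_simps(4) M.l_neg)
  next
    show "\<zero>\<^bsub>quotient_space X N\<^esub> \<in> carrier (quotient_space X N)"
      using coset_in_quotient[of \<zero>] by (simp add: coset_zero quotient_space_simps(4))
  qed (auto elim!: quotient_cases simp: M.a_ac)
qed (auto elim!: quotient_cases simp: cring_scalar_space smult_add_left smult_add_right smult_smult)

text \<open>The norm inequalities for cosets follow from those for representatives that attain the
  infimum up to a small error.\<close>

lemma normed_space_quotient: "normed_space (quotient_space X N)"
proof (rule normed_spaceI[OF module_quotient])
  fix A assume "A \<in> carrier (quotient_space X N)"
  then obtain x where x: "x \<in> carrier X" and A: "A = N +> x" by (rule quotient_cases)
  show "0 \<le> vnorm (quotient_space X N) A"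
    using x by (auto simp: A mem_coset_iff intro!: coset_norm_greatest vnorm_nonneg)
  show "A = \<zero>\<^bsub>quotient_space X N\<^esub>" if 0: "vnorm (quotient_space X N) A = 0"
  proof -
    \<comment> \<open>A representative z of norm below \<open>e\<close> has the form x - y with y =
      -(z - x) in \<open>N\<close>. Hence \<open>x\<close> is a limit of points of
      \<open>N\<close>.\<close>
    have "\<exists>y\<in>N. vnorm X (x \<ominus> y) < e" if "e > 0" for e
    proof -
      obtain z where z: "z \<in> N +> x" "vnorm X z < e"
        using coset_norm_approx[OF x \<open>e > 0\<close>] 0 by (auto simp: A)
      then have zx: "z \<in> carrier X" "z \<ominus> x \<in> N" using x by (simp_all add: mem_coset_iff)
      have "x \<ominus> (\<ominus> (z \<ominus> x)) = z \<oplus> (x \<oplus> \<ominus> x)"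
        using x zx by (simp add: a_minus_def M.a_lcomm)
      then have "x \<ominus> (\<ominus> (z \<ominus> x)) = z"
        using x zx by (simp add: M.r_neg)
      then show ?thesis
        using z zx(2) by (intro bexI[of _ "\<ominus> (z \<ominus> x)"]) simp_all
    qed
    then have "x \<in> N"
      using closed_N x by (auto simp: closed_subspace_iff)
    then show ?thesis
      using x coset_eq_iff[of x \<zero>] by (simp add: A coset_zero quotient_space_simps(4) a_minus_def)
  qed
  show "vnorm (quotient_space X N) (c \<odot>\<^bsub>quotient_space X N\<^esub> A) \<le> norm c * vnorm (quotient_space X N) A" for c
  proof (rule field_le_epsilon)
    fix e :: real assume "e > 0"
    \<comment> \<open>The summand 1 keeps the denominator positive also for c = 0, and
      \<open>norm c * d\<close> is still at most \<open>e\<close>.\<close>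
    define d where "d = e / (norm c + 1)"
    have d: "d > 0" "norm c * d \<le> e"
      using \<open>e > 0\<close> by (simp_all add: d_def field_simps add_pos_nonneg pos_divide_le_eq)
    obtain z where z: "z \<in> N +> x" "vnorm X z < vnorm (quotient_space X N) (N +> x) + d"
      using coset_norm_approx[OF x d(1)] by blast
    then have zx: "z \<in> carrier X" "N +> z = N +> x"
      using x coset_eq_iff by (auto simp: mem_coset_iff)
    have "vnorm (quotient_space X N) (c \<odot>\<^bsub>quotient_space X N\<^esub> A) = vnorm (quotient_space X N) (N +> (c \<odot> z))"
      using x zx coset_smult[of z c] coset_smult[of x c] by (simp add: A)
    also have "\<dots> \<le> norm c * vnorm X z"
      using coset_norm_le[of "c \<odot> z" "c \<odot> z"] N.a_rcos_self[of "c \<odot> z"] zx by (simp add: vnorm_smult)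
    also have "\<dots> \<le> norm c * (vnorm (quotient_space X N) (N +> x) + d)"
      using z by (intro mult_left_mono) simp_all
    finally show "vnorm (quotient_space X N) (c \<odot>\<^bsub>quotient_space X N\<^esub> A) \<le> norm c * vnorm (quotient_space X N) A + e"
      using d by (simp add: A distrib_left)
  qed
  fix B assume "B \<in> carrier (quotient_space X N)"
  then obtain y where y: "y \<in> carrier X" and B: "B = N +> y" by (rule quotient_cases)
  show "vnorm (quotient_space X N) (A \<oplus>\<^bsub>quotient_space X N\<^esub> B)
    \<le> vnorm (quotient_space X N) A + vnorm (quotient_space X N) B"
  proof (rule field_le_epsilon)
    fix e :: real assume "e > 0"
    then have e: "e / 2 > 0" by simp
    obtain z where z: "z \<in> N +> x" "vnorm X z < vnorm (quotient_space X N) (N +> x) + e / 2"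
      using coset_norm_approx[OF x e] by blast
    obtain w where w: "w \<in> N +> y" "vnorm X w < vnorm (quotient_space X N) (N +> y) + e / 2"
      using coset_norm_approx[OF y e] by blast
    have zx: "z \<in> carrier X" "N +> z = N +> x" and wy: "w \<in> carrier X" "N +> w = N +> y"
      using x y z w coset_eq_iff by (auto simp: mem_coset_iff)
    have "A \<oplus>\<^bsub>quotient_space X N\<^esub> B = N +> (z \<oplus> w)"
      using zx wy coset_add[of z w] by (simp add: A B)
    moreover have "vnorm (quotient_space X N) (N +> (z \<oplus> w)) \<le> vnorm X z + vnorm X w"
      using coset_norm_le[of "z \<oplus> w" "z \<oplus> w"] N.a_rcos_self[of "z \<oplus> w"] vnorm_triangle[of z w] zx wy by simp
    ultimately show "vnorm (quotient_space X N) (A \<oplus>\<^bsub>quotient_space X N\<^esub> B)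
      \<le> vnorm (quotient_space X N) A + vnorm (quotient_space X N) B + e"
      using z w by (simp add: A B)
  qed
next
  show "vnorm (quotient_space X N) \<zero>\<^bsub>quotient_space X N\<^esub> = 0"
  proof (rule antisym)
    show "vnorm (quotient_space X N) \<zero>\<^bsub>quotient_space X N\<^esub> \<le> 0"
      using coset_norm_le[of \<zero> \<zero>] by (simp add: coset_zero quotient_space_simps(4))
    show "0 \<le> vnorm (quotient_space X N) \<zero>\<^bsub>quotient_space X N\<^esub>"
      using coset_norm_greatest[of \<zero> 0] N_subset vnorm_nonneg
      by (simp add: coset_zero quotient_space_simps(4) subset_iff)
  qed
qed

lemma quotient_operator_apply [simp]: "x \<in> carrier X \<Longrightarrow> quotient_operator X N x = N +> x"
  by (simp add: quotient_operator_def)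

lemma bounded_operator_quotient: "bounded_operator X (quotient_space X N) (quotient_operator X N)"
  by (rule bounded_operatorI[where C = 1]) (auto intro: coset_norm_le N.a_rcos_self)

end

section \<open>Dual spaces\<close>

lemma dual_space_simps [simp]:
  "f \<oplus>\<^bsub>dual_space X\<^esub> g = (\<lambda>x\<in>carrier X. f x + g x)"
  "c \<odot>\<^bsub>dual_space X\<^esub> f = (\<lambda>x\<in>carrier X. c * f x)"
  "\<zero>\<^bsub>dual_space X\<^esub> = (\<lambda>x\<in>carrier X. 0)"
  by (simp_all add: dual_space_def)

lemma in_dual_iff:
  "f \<in> carrier (dual_space X) \<longleftrightarrow> f \<in> extensional (carrier X) \<and> bounded_operator X scalar_space f"
  by (simp add: dual_space_def)

lemma dualD:
  assumes "f \<in> carrier (dual_space X)"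
  shows "bounded_operator X scalar_space f"
    and "x \<in> carrier X \<Longrightarrow> y \<in> carrier X \<Longrightarrow> f (x \<oplus>\<^bsub>X\<^esub> y) = f x + f y"
    and "x \<in> carrier X \<Longrightarrow> f (c \<odot>\<^bsub>X\<^esub> x) = c * f x"
  using assms bounded_operatorD[of X scalar_space f] by (simp_all add: in_dual_iff)

lemma dual_eqI:
  assumes "f \<in> carrier (dual_space X)" "g \<in> carrier (dual_space X)" "\<And>x. x \<in> carrier X \<Longrightarrow> f x = g x"
  shows "f = g"
  using assms by (auto simp: in_dual_iff intro: extensionalityI)

context normed_space
begin

lemma restrict_in_dual:
  "bounded_operator X scalar_space f \<Longrightarrow> (\<lambda>x\<in>carrier X. f x) \<in> carrier (dual_space X)"
  by (auto simp: in_dual_iff intro: bounded_operator_cong)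

lemma in_dualI:
  assumes "f \<in> extensional (carrier X)"
    and "\<And>x y. x \<in> carrier X \<Longrightarrow> y \<in> carrier X \<Longrightarrow> f (x \<oplus> y) = f x + f y"
    and "\<And>c x. x \<in> carrier X \<Longrightarrow> f (c \<odot> x) = c * f x"
    and "\<And>x. x \<in> carrier X \<Longrightarrow> norm (f x) \<le> C * vnorm X x"
  shows "f \<in> carrier (dual_space X)"
  unfolding in_dual_iff using assms by (auto intro!: bounded_operatorI[where C = C])

lemma dual_zero_apply:
  assumes "f \<in> carrier (dual_space X)" shows "f \<zero> = 0"
  using dualD(3)[OF assms, of \<zero> 0] by simp

text \<open>Rescaling moves \<open>x\<close> into the unit ball, where the supremum defining the
  dual norm is taken. Boundedness of \<open>f\<close> makes this supremum an actual upper
  bound.\<close>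

lemma dual_norm_bound:
  assumes f: "f \<in> carrier (dual_space X)" and x: "x \<in> carrier X"
  shows "norm (f x) \<le> vnorm (dual_space X) f * vnorm X x"
proof -
  obtain C where C: "0 \<le> C" "\<And>x. x \<in> carrier X \<Longrightarrow> norm (f x) \<le> C * vnorm X x"
    using bounded_operator_bound[OF dualD(1)[OF f]] by (metis scalar_space_simps(7))
  show ?thesis
  proof (cases "vnorm X x = 0")
    case True
    then show ?thesis using C(2)[OF x] by simp
  next
    case False
    then have pos: "vnorm X x > 0" using vnorm_nonneg[OF x] by simp
    define y where "y = of_real (1 / vnorm X x) \<odot> x"
    have y: "y \<in> carrier X" "vnorm X y \<le> 1"
      using x pos by (simp_all add: y_def vnorm_smult norm_divide)
    have "norm (f z) \<le> C" if "z \<in> carrier X" "vnorm X z \<le> 1" for z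
      using C(2)[OF that(1)] mult_left_mono[OF that(2) C(1)] by simp
    then have "bdd_above ((\<lambda>x. norm (f x)) ` {x \<in> carrier X. vnorm X x \<le> 1})"
      by (auto simp: bdd_above_def)
    from cSUP_upper[OF _ this, of y] have "norm (f y) \<le> vnorm (dual_space X) f"
      using y by (simp add: dual_space_def)
    moreover have "norm (f y) = norm (f x) / vnorm X x"
      using pos x by (simp add: y_def dualD(3)[OF f] norm_mult norm_divide)
    ultimately show ?thesis
      using pos by (simp add: pos_divide_le_eq)
  qed
qed

lemma dual_norm_le:
  assumes "0 \<le> C" "\<And>x. x \<in> carrier X \<Longrightarrow> norm (f x) \<le> C * vnorm X x"
  shows "vnorm (dual_space X) f \<le> C"
proof -
  have "norm (f x) \<le> C" if "x \<in> carrier X" "vnorm X x \<le> 1" for x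
    using assms(2)[OF that(1)] mult_left_mono[OF that(2) assms(1)] by simp
  \<comment> \<open>A supremum of reals is below every upper bound only if the set is
    nonempty.\<close>
  moreover have "\<zero> \<in> {x \<in> carrier X. vnorm X x \<le> 1}" by simp
  ultimately show ?thesis
    by (auto simp: dual_space_def intro!: cSUP_least)
qed

lemma dual_norm_nonneg:
  assumes f: "f \<in> carrier (dual_space X)"
  shows "0 \<le> vnorm (dual_space X) f"
proof -
  obtain C where C: "0 \<le> C" "\<And>x. x \<in> carrier X \<Longrightarrow> norm (f x) \<le> C * vnorm X x"
    using bounded_operator_bound[OF dualD(1)[OF f]] by (metis scalar_space_simps(7))
  have "norm (f z) \<le> C" if "z \<in> carrier X" "vnorm X z \<le> 1" for z
    using C(2)[OF that(1)] mult_left_mono[OF that(2) C(1)] by simp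
  then have "bdd_above ((\<lambda>x. norm (f x)) ` {x \<in> carrier X. vnorm X x \<le> 1})"
    by (auto simp: bdd_above_def)
  from cSUP_upper[OF _ this, of \<zero>] have "norm (f \<zero>) \<le> vnorm (dual_space X) f"
    by (simp add: dual_space_def)
  then show ?thesis using norm_ge_zero order_trans by blast
qed

lemma normed_space_dual: "normed_space (dual_space X)"
proof (rule normed_spaceI)
  note [simp] = dualD(2,3)
  have zero: "(\<lambda>x\<in>carrier X. 0) \<in> carrier (dual_space X)"
    by (rule in_dualI[where C = 0]) auto
  have smult: "(\<lambda>x\<in>carrier X. c * f x) \<in> carrier (dual_space X)" if f: "f \<in> carrier (dual_space X)" for c f
    by (rule in_dualI[where C = "norm c * vnorm (dual_space X) f"])
      (use dual_norm_bound[OF f] f in \<open>auto simp: algebra_simps norm_mult intro: mult_left_mono\<close>)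
  have add_bound: "norm (f x + g x) \<le> (vnorm (dual_space X) f + vnorm (dual_space X) g) * vnorm X x"
    if "f \<in> carrier (dual_space X)" "g \<in> carrier (dual_space X)" "x \<in> carrier X" for f g x
    using norm_triangle_ineq[of "f x" "g x"] dual_norm_bound[OF that(1,3)] dual_norm_bound[OF that(2,3)]
    by (simp add: distrib_right)
  have add: "(\<lambda>x\<in>carrier X. f x + g x) \<in> carrier (dual_space X)"
    if "f \<in> carrier (dual_space X)" "g \<in> carrier (dual_space X)" for f g
    by (rule in_dualI[where C = "vnorm (dual_space X) f + vnorm (dual_space X) g"])
      (use that add_bound[OF that] in \<open>auto simp: algebra_simps\<close>)
  have ext: "f \<in> carrier (dual_space X) \<Longrightarrow> f \<in> extensional (carrier X)" for f
    by (simp add: in_dual_iff)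
  show "module scalar_space (dual_space X)"
  proof (rule moduleI)
    show "abelian_group (dual_space X)"
    proof (rule abelian_groupI)
      fix f assume f: "f \<in> carrier (dual_space X)"
      show "\<zero>\<^bsub>dual_space X\<^esub> \<oplus>\<^bsub>dual_space X\<^esub> f = f"
        using ext[OF f] by (auto intro!: extensionalityI[of _ "carrier X"])
      show "\<exists>g\<in>carrier (dual_space X). g \<oplus>\<^bsub>dual_space X\<^esub> f = \<zero>\<^bsub>dual_space X\<^esub>"
        using smult[OF f, of "- 1"] by (intro bexI[of _ "\<lambda>x\<in>carrier X. - 1 * f x"]) auto
    qed (auto simp: zero add fun_eq_iff add.commute add.assoc)
  qed (auto simp: cring_scalar_space smult algebra_simps fun_eq_iff extensional_arb[OF ext])
  fix f assume f: "f \<in> carrier (dual_space X)"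
  show "0 \<le> vnorm (dual_space X) f"
    by (rule dual_norm_nonneg[OF f])
  show "f = \<zero>\<^bsub>dual_space X\<^esub>" if "vnorm (dual_space X) f = 0"
    using that dual_norm_bound[OF f] by (intro dual_eqI[OF f]) (simp_all add: zero)
  show "vnorm (dual_space X) (c \<odot>\<^bsub>dual_space X\<^esub> f) \<le> norm c * vnorm (dual_space X) f" for c
    using dual_norm_bound[OF f] dual_norm_nonneg[OF f]
    by (intro dual_norm_le) (auto simp: norm_mult mult.assoc intro: mult_left_mono)
  show "vnorm (dual_space X) (f \<oplus>\<^bsub>dual_space X\<^esub> g) \<le> vnorm (dual_space X) f + vnorm (dual_space X) g"
    if g: "g \<in> carrier (dual_space X)" for g
    using add_bound[OF f g] dual_norm_nonneg f g by (intro dual_norm_le) auto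
next
  show "vnorm (dual_space X) \<zero>\<^bsub>dual_space X\<^esub> = 0"
  proof (rule antisym)
    show "vnorm (dual_space X) \<zero>\<^bsub>dual_space X\<^esub> \<le> 0"
      by (rule dual_norm_le) auto
    show "0 \<le> vnorm (dual_space X) \<zero>\<^bsub>dual_space X\<^esub>"
      by (rule dual_norm_nonneg) (auto intro: in_dualI[where C = 0])
  qed
qed

end


section \<open>Conjugate operators\<close>

definition canonical_functional ::
    "('k::real_or_complex, 'a) normed_module \<Rightarrow> 'a \<Rightarrow> (('a \<Rightarrow> 'k) \<Rightarrow> 'k)" where
  "canonical_functional X x = (\<lambda>f\<in>carrier (dual_space X). f x)"

lemma canonical_image_eq: "canonical_image X = canonical_functional X ` carrier X"
  by (simp add: canonical_image_def canonical_functional_def)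

lemma canonical_functional_apply [simp]:
  "f \<in> carrier (dual_space X) \<Longrightarrow> canonical_functional X x f = f x"
  by (simp add: canonical_functional_def)

lemma canonical_functional_in_bidual:
  assumes "normed_space X" "x \<in> carrier X"
  shows "canonical_functional X x \<in> carrier (bidual_space X)"
proof -
  interpret X: normed_space X by fact
  interpret D: normed_space "dual_space X" by (rule X.normed_space_dual)
  show ?thesis
  proof (rule D.in_dualI)
    show "norm (canonical_functional X x f) \<le> vnorm X x * vnorm (dual_space X) f"
      if "f \<in> carrier (dual_space X)" for f
      using X.dual_norm_bound[OF that assms(2)] that by (simp add: mult.commute)
    show "canonical_functional X x (f \<oplus>\<^bsub>dual_space X\<^esub> g) = canonical_functional X x f + canonical_functional X x g"
      if "f \<in> carrier (dual_space X)" "g \<in> carrier (dual_space X)" for f g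
      using D.M.a_closed[OF that] that assms(2) by simp
    show "canonical_functional X x (c \<odot>\<^bsub>dual_space X\<^esub> f) = c * canonical_functional X x f"
      if "f \<in> carrier (dual_space X)" for c f
      using D.smult_in_carrier[OF that, of c] that assms(2) by simp
  qed (simp add: canonical_functional_def)
qed

lemma conjugate_apply:
  "g \<in> carrier (dual_space Y) \<Longrightarrow> x \<in> carrier X \<Longrightarrow> conjugate X Y S g x = g (S x)"
  by (simp add: conjugate_def)

lemma bounded_operator_conjugate:
  assumes X: "normed_space X" and Y: "normed_space Y" and S: "bounded_operator X Y S"
  shows "bounded_operator (dual_space Y) (dual_space X) (conjugate X Y S)"
proof -
  interpret X: normed_space X by fact
  interpret Y: normed_space Y by fact
  interpret D: normed_space "dual_space Y" by (rule Y.normed_space_dual)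
  obtain C where C: "0 \<le> C" "\<And>x. x \<in> carrier X \<Longrightarrow> vnorm Y (S x) \<le> C * vnorm X x"
    using X.bounded_operator_bound[OF S] by blast
  note S' = bounded_operatorD[OF S]
  show ?thesis
  proof (rule bounded_operatorI)
    fix g assume g: "g \<in> carrier (dual_space Y)"
    show "conjugate X Y S g \<in> carrier (dual_space X)"
      using X.restrict_in_dual[OF X.bounded_operator_comp[OF S dualD(1)[OF g] Y]] g
      by (simp add: conjugate_def)
    show "conjugate X Y S (c \<odot>\<^bsub>dual_space Y\<^esub> g) = c \<odot>\<^bsub>dual_space X\<^esub> conjugate X Y S g" for c
      using D.smult_in_carrier[OF g, of c] g S'(1) by (auto simp: conjugate_def fun_eq_iff)
    show "conjugate X Y S (g \<oplus>\<^bsub>dual_space Y\<^esub> h) = conjugate X Y S g \<oplus>\<^bsub>dual_space X\<^esub> conjugate X Y S h"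
      if h: "h \<in> carrier (dual_space Y)" for h
      using D.M.a_closed[OF g h] g h S'(1) by (auto simp: conjugate_def fun_eq_iff)
    show "vnorm (dual_space X) (conjugate X Y S g) \<le> C * vnorm (dual_space Y) g"
    proof (rule X.dual_norm_le)
      show "0 \<le> C * vnorm (dual_space Y) g"
        using C(1) Y.dual_norm_nonneg[OF g] by simp
      fix x assume x: "x \<in> carrier X"
      have "norm (g (S x)) \<le> vnorm (dual_space Y) g * vnorm Y (S x)"
        by (rule Y.dual_norm_bound[OF g S'(1)[OF x]])
      also have "\<dots> \<le> vnorm (dual_space Y) g * (C * vnorm X x)"
        by (rule mult_left_mono[OF C(2)[OF x] Y.dual_norm_nonneg[OF g]])
      finally show "norm (conjugate X Y S g x) \<le> C * vnorm (dual_space Y) g * vnorm X x"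
        using g x by (simp add: conjugate_apply mult_ac)
    qed
  qed
qed

text \<open>Conjugation reverses the order of factors. \<open>T\<close> only has to agree with the
  composition on the carrier, since operators, unlike functionals, may take any values
  elsewhere.\<close>

lemma conjugate_comp:
  assumes Y: "normed_space Y" and S: "bounded_operator X Y S" and R: "bounded_operator Y Z R"
    and T: "\<And>x. x \<in> carrier X \<Longrightarrow> T x = R (S x)"
    and X: "normed_space X" and Z: "normed_space Z" and h: "h \<in> carrier (dual_space Z)"
  shows "conjugate X Z T h = conjugate X Y S (conjugate Y Z R h)"
  using bounded_operatorD(1)[OF bounded_operator_conjugate[OF Y Z R] h] h bounded_operatorD(1)[OF S]
  by (auto simp: conjugate_def T fun_eq_iff)

lemma biconjugate_apply:
  "\<xi> \<in> carrier (bidual_space X) \<Longrightarrow> g \<in> carrier (dual_space Y) \<Longrightarrow> biconjugate X Y S \<xi> g = \<xi> (conjugate X Y S g)"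
  by (rule conjugate_apply)

lemma biconjugate_in_bidual:
  assumes "normed_space X" "normed_space Y" "bounded_operator X Y S" "\<xi> \<in> carrier (bidual_space X)"
  shows "biconjugate X Y S \<xi> \<in> carrier (bidual_space Y)"
  using assms by (intro bounded_operatorD(1)[OF bounded_operator_conjugate] bounded_operator_conjugate
      normed_space.normed_space_dual)

text \<open>Both sides send a functional g to g (S x). This is the sense in which
  \<open>S\<^sup>*\<^sup>*\<close> extends \<open>S\<close> once spaces are identified with their
  canonical images.\<close>

lemma biconjugate_canonical:
  assumes X: "normed_space X" and Y: "normed_space Y" and S: "bounded_operator X Y S" and x: "x \<in> carrier X"
  shows "biconjugate X Y S (canonical_functional X x) = canonical_functional Y (S x)"
proof (rule dual_eqI)
  show "biconjugate X Y S (canonical_functional X x) \<in> carrier (bidual_space Y)"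
    by (rule biconjugate_in_bidual[OF X Y S canonical_functional_in_bidual[OF X x]])
  show "canonical_functional Y (S x) \<in> carrier (bidual_space Y)"
    by (rule canonical_functional_in_bidual[OF Y bounded_operatorD(1)[OF S x]])
  show "biconjugate X Y S (canonical_functional X x) g = canonical_functional Y (S x) g"
    if "g \<in> carrier (dual_space Y)" for g
    using that x bounded_operatorD(1)[OF bounded_operator_conjugate[OF X Y S] that]
      canonical_functional_in_bidual[OF X x]
    by (simp add: biconjugate_apply conjugate_apply)
qed


section \<open>Tauberian and cotauberian operators\<close>

text \<open>A biconjugate always maps into the bidual, so the only content of the definition is the
  contrapositive of avoiding the canonical image.\<close>

lemma tauberian_iff:
  assumes "normed_space X" "normed_space Y" "bounded_operator X Y S"
  shows "tauberian X Y S \<longleftrightarrow> (\<forall>\<xi>\<in>carrier (bidual_space X).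
    biconjugate X Y S \<xi> \<in> canonical_image Y \<longrightarrow> \<xi> \<in> canonical_image X)"
  using biconjugate_in_bidual[OF assms] assms(3) unfolding tauberian_def by blast

lemma biconjugate_comp:
  assumes X: "normed_space X" and Y: "normed_space Y" and Z: "normed_space Z"
    and S: "bounded_operator X Y S" and R: "bounded_operator Y Z R"
    and T: "\<And>x. x \<in> carrier X \<Longrightarrow> T x = R (S x)"
    and \<xi>: "\<xi> \<in> carrier (bidual_space X)"
  shows "biconjugate X Z T \<xi> = biconjugate Y Z R (biconjugate X Y S \<xi>)"
  using \<xi> by (intro conjugate_comp bounded_operator_conjugate conjugate_comp[OF Y S R T X Z]
      normed_space.normed_space_dual X Y Z S R)

lemma bounded_operator_comp_cong:
  assumes X: "normed_space X" and Y: "normed_space Y"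
    and S: "bounded_operator X Y S" and R: "bounded_operator Y Z R"
    and T: "\<And>x. x \<in> carrier X \<Longrightarrow> T x = R (S x)"
  shows "bounded_operator X Z T"
  by (rule normed_space.bounded_operator_cong[OF X normed_space.bounded_operator_comp[OF X S R Y] T])

text \<open>If \<open>T\<^sup>*\<^sup>*\<close> sends an element into the canonical image of
  \<open>Z\<close>, then \<open>R\<close> pulls this back to the canonical image of
  \<open>Y\<close>, and \<open>S\<close> to that of \<open>X\<close>.\<close>

lemma tauberian_comp:
  assumes X: "normed_space X" and Y: "normed_space Y" and Z: "normed_space Z"
    and S: "tauberian X Y S" and R: "tauberian Y Z R"
    and T: "\<And>x. x \<in> carrier X \<Longrightarrow> T x = R (S x)"
  shows "tauberian X Z T"
proof -
  have bS: "bounded_operator X Y S" and bR: "bounded_operator Y Z R"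
    using S R by (simp_all add: tauberian_def)
  have bT: "bounded_operator X Z T"
    by (rule bounded_operator_comp_cong[OF X Y bS bR T])
  show ?thesis
    using S R biconjugate_comp[OF X Y Z bS bR T] biconjugate_in_bidual[OF X Y bS]
    unfolding tauberian_iff[OF X Y bS] tauberian_iff[OF Y Z bR] tauberian_iff[OF X Z bT] by simp
qed

text \<open>If \<open>S\<^sup>*\<^sup>* \<xi>\<close> comes from a vector y, then
  \<open>T\<^sup>*\<^sup>* \<xi>\<close> comes from R y, and the hypothesis on \<open>T\<close>
  applies to \<open>\<xi>\<close>.\<close>

lemma tauberian_right_factor:
  assumes X: "normed_space X" and Y: "normed_space Y" and Z: "normed_space Z"
    and S: "bounded_operator X Y S" and R: "bounded_operator Y Z R"
    and T: "\<And>x. x \<in> carrier X \<Longrightarrow> T x = R (S x)" and tT: "tauberian X Z T"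
  shows "tauberian X Y S"
  unfolding tauberian_iff[OF X Y S]
proof (intro ballI impI)
  fix \<xi> assume \<xi>: "\<xi> \<in> carrier (bidual_space X)" and "biconjugate X Y S \<xi> \<in> canonical_image Y"
  then obtain y where y: "y \<in> carrier Y" "biconjugate X Y S \<xi> = canonical_functional Y y"
    by (auto simp: canonical_image_eq)
  have "biconjugate X Z T \<xi> = canonical_functional Z (R y)"
    using biconjugate_comp[OF X Y Z S R T \<xi>] biconjugate_canonical[OF Y Z R y(1)] by (simp add: y(2))
  then have "biconjugate X Z T \<xi> \<in> canonical_image Z"
    using bounded_operatorD(1)[OF R y(1)] by (simp add: canonical_image_eq)
  then show "\<xi> \<in> canonical_image X"
    using tT \<xi> tauberian_iff[OF X Z] by (auto simp: tauberian_def)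
qed

text \<open>Conjugation turns the factorization into \<open>T\<^sup>* = S\<^sup>* R\<^sup>*\<close>,
  a composition of tauberian operators with \<open>R\<^sup>*\<close> acting first.\<close>

lemma cotauberian_comp:
  assumes X: "normed_space X" and Y: "normed_space Y" and Z: "normed_space Z"
    and S: "cotauberian X Y S" and R: "cotauberian Y Z R"
    and T: "\<And>x. x \<in> carrier X \<Longrightarrow> T x = R (S x)"
  shows "cotauberian X Z T"
proof -
  have b: "bounded_operator X Y S" "bounded_operator Y Z R"
    using S R by (simp_all add: cotauberian_def)
  have "tauberian (dual_space Z) (dual_space X) (conjugate X Z T)"
    by (rule tauberian_comp[where Y = "dual_space Y" and R = "conjugate X Y S" and S = "conjugate Y Z R"])
      (use S R in \<open>auto simp: cotauberian_def intro: normed_space.normed_space_dual X Y Z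
        conjugate_comp[OF Y b T X Z]\<close>)
  then show ?thesis
    using bounded_operator_comp_cong[OF X Y b T] by (simp add: cotauberian_def)
qed

text \<open>In \<open>T\<^sup>* = S\<^sup>* R\<^sup>*\<close> the left factor \<open>R\<close> of
  \<open>T\<close> becomes the right factor, to which the tauberian statement applies.\<close>

lemma cotauberian_left_factor:
  assumes X: "normed_space X" and Y: "normed_space Y" and Z: "normed_space Z"
    and S: "bounded_operator X Y S" and R: "bounded_operator Y Z R"
    and T: "\<And>x. x \<in> carrier X \<Longrightarrow> T x = R (S x)" and cT: "cotauberian X Z T"
  shows "cotauberian Y Z R"
proof -
  have "tauberian (dual_space Z) (dual_space Y) (conjugate Y Z R)"
    by (rule tauberian_right_factor[where Z = "dual_space X" and R = "conjugate X Y S" and T = "conjugate X Z T"])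
      (use cT in \<open>auto simp: cotauberian_def intro: normed_space.normed_space_dual X Y Z S R
        bounded_operator_conjugate conjugate_comp[OF Y S R T X Z]\<close>)
  then show ?thesis
    using R by (simp add: cotauberian_def)
qed

lemma normed_space_scalar_space: "normed_space (scalar_space :: ('k::real_or_complex, 'k) normed_module)"
proof (rule normed_spaceI)
  show "module scalar_space (scalar_space :: ('k, 'k) normed_module)"
    using cring_scalar_space
    by (intro moduleI) (auto simp: cring.axioms algebra_simps cring_def ring_def)
qed (simp_all add: norm_triangle_ineq norm_mult)

section \<open>Factorization through quotients; quotient maps and inclusions\<close>

context closed_subspace_quotient
begin

text \<open>For positive \<open>C\<close>, dividing by it turns the hypothesis into a lower bound
  for the infimum; C = 0 is read off from one representative.\<close>

lemma coset_norm_bound: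
  assumes x: "x \<in> carrier X" and C: "0 \<le> C" and b: "\<And>z. z \<in> N +> x \<Longrightarrow> b \<le> C * vnorm X z"
  shows "b \<le> C * vnorm (quotient_space X N) (N +> x)"
proof (cases "C = 0")
  case True
  then show ?thesis using b[OF N.a_rcos_self[OF x]] by simp
next
  case False
  then have "b / C \<le> vnorm (quotient_space X N) (N +> x)"
    using C b by (intro coset_norm_greatest[OF x]) (simp add: pos_divide_le_eq mult.commute)
  then show ?thesis
    using False C by (simp add: pos_divide_le_eq mult.commute)
qed

text \<open>\<open>S\<close> is constant on cosets because it kills \<open>N\<close>, so any choice
  of representatives defines \<open>B\<close>. The norm estimate holds for all representatives at
  once and hence for their infimum.\<close>

lemma quotient_factor:
  assumes Z: "normed_space Z" and S: "bounded_operator X Z S"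
    and ker: "\<And>x. x \<in> N \<Longrightarrow> S x = \<zero>\<^bsub>Z\<^esub>"
  obtains B where "bounded_operator (quotient_space X N) Z B" "\<And>x. x \<in> carrier X \<Longrightarrow> B (N +> x) = S x"
proof -
  interpret Z: normed_space Z by fact
  define B where "B A = S (SOME x. x \<in> A)" for A
  have const: "S z = S x" if x: "x \<in> carrier X" and z: "z \<in> N +> x" for x z
  proof -
    have "z \<in> carrier X" "z \<ominus> x \<in> N" using mem_coset_iff[OF x] z by blast+
    then have "S z \<ominus>\<^bsub>Z\<^esub> S x = \<zero>\<^bsub>Z\<^esub>"
      using bounded_operator_diff[OF S Z _ x] ker by metis
    then show ?thesis
      using Z.right_minus_eq bounded_operatorD(1)[OF S] x \<open>z \<in> carrier X\<close> by blast
  qed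
  have B: "B (N +> x) = S x" if x: "x \<in> carrier X" for x
    unfolding B_def using const[OF x] someI[of "\<lambda>z. z \<in> N +> x", OF N.a_rcos_self[OF x]] by blast
  obtain C where C: "0 \<le> C" "\<And>x. x \<in> carrier X \<Longrightarrow> vnorm Z (S x) \<le> C * vnorm X x"
    using bounded_operator_bound[OF S] by blast
  have "bounded_operator (quotient_space X N) Z B"
  proof (rule bounded_operatorI)
    fix A assume "A \<in> carrier (quotient_space X N)"
    then obtain x where x: "x \<in> carrier X" and A: "A = N +> x" by (rule quotient_cases)
    show "B A \<in> carrier Z"
      using x by (simp add: A B bounded_operatorD[OF S])
    show "B (c \<odot>\<^bsub>quotient_space X N\<^esub> A) = c \<odot>\<^bsub>Z\<^esub> B A" for c
      using x by (simp add: A B bounded_operatorD[OF S])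
    have "vnorm Z (S x) \<le> C * vnorm X z" if "z \<in> N +> x" for z
      using C(2)[of z] const[OF x that] that mem_coset_iff[OF x, of z] by simp
    then show "vnorm Z (B A) \<le> C * vnorm (quotient_space X N) A"
      unfolding A B[OF x] by (rule coset_norm_bound[OF x C(1)])
    fix A' assume "A' \<in> carrier (quotient_space X N)"
    then obtain y where y: "y \<in> carrier X" and A': "A' = N +> y" by (rule quotient_cases)
    show "B (A \<oplus>\<^bsub>quotient_space X N\<^esub> A') = B A \<oplus>\<^bsub>Z\<^esub> B A'"
      using x y by (simp add: A A' B bounded_operatorD[OF S])
  qed
  then show ?thesis using B that by blast
qed

lemma conjugate_quotient_apply:
  "\<psi> \<in> carrier (dual_space (quotient_space X N)) \<Longrightarrow> x \<in> carrier X \<Longrightarrow>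
    conjugate X (quotient_space X N) (quotient_operator X N) \<psi> x = \<psi> (N +> x)"
  by (simp add: conjugate_apply)

text \<open>The value of \<open>\<psi>\<close> on a coset is the value of its conjugate at every
  representative. The resulting estimate says that the inverse of \<open>Q\<^sup>*\<close> on its
  range is bounded.\<close>

lemma conjugate_quotient_norm:
  assumes \<psi>: "\<psi> \<in> carrier (dual_space (quotient_space X N))"
  shows "vnorm (dual_space (quotient_space X N)) \<psi>
    \<le> vnorm (dual_space X) (conjugate X (quotient_space X N) (quotient_operator X N) \<psi>)" (is "_ \<le> vnorm _ ?f")
proof -
  interpret Q: normed_space "quotient_space X N" by (rule normed_space_quotient)
  have f: "?f \<in> carrier (dual_space X)"
    by (rule bounded_operatorD(1)[OF bounded_operator_conjugate[OF normed_space_axioms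
          normed_space_quotient bounded_operator_quotient] \<psi>])
  show ?thesis
  proof (rule Q.dual_norm_le[OF dual_norm_nonneg[OF f]])
    fix A assume "A \<in> carrier (quotient_space X N)"
    then obtain x where x: "x \<in> carrier X" and A: "A = N +> x" by (rule quotient_cases)
    have "norm (\<psi> A) \<le> vnorm (dual_space X) ?f * vnorm X z" if "z \<in> N +> x" for z
    proof -
      have z: "z \<in> carrier X" "z \<ominus> x \<in> N" using mem_coset_iff[OF x] that by blast+
      then have "\<psi> A = ?f z"
        using conjugate_quotient_apply[OF \<psi> z(1)] coset_eq_iff[OF z(1) x] by (simp add: A)
      then show ?thesis using dual_norm_bound[OF f z(1)] by simp
    qed
    then show "norm (\<psi> A) \<le> vnorm (dual_space X) ?f * vnorm (quotient_space X N) A"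
      unfolding A by (rule coset_norm_bound[OF x dual_norm_nonneg[OF f]])
  qed
qed

end

lemma submodule_image:
  assumes X: "normed_space X" and Y: "normed_space Y" and S: "bounded_operator X Y S"
    and M: "submodule M scalar_space X"
  shows "submodule (S ` M) scalar_space Y"
proof -
  interpret X: normed_space X by fact
  interpret Y: normed_space Y by fact
  note M' = X.submoduleE[OF M]
  have car: "x \<in> carrier X" if "x \<in> M" for x using that M'(1) by blast
  show ?thesis
  proof (rule Y.submoduleI')
    show "S ` M \<subseteq> carrier Y"
      using car bounded_operatorD(1)[OF S] by blast
    show "\<zero>\<^bsub>Y\<^esub> \<in> S ` M"
      using X.submodule_zero[OF M] X.bounded_operator_zero[OF S Y] by (metis imageI)
    show "x \<oplus>\<^bsub>Y\<^esub> y \<in> S ` M" if "x \<in> S ` M" "y \<in> S ` M" for x y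
      using that M'(5) car by (auto simp: bounded_operatorD(2)[OF S, symmetric])
    show "c \<odot>\<^bsub>Y\<^esub> x \<in> S ` M" if "x \<in> S ` M" for c x
      using that M'(4) car by (auto simp: bounded_operatorD(3)[OF S, symmetric])
  qed
qed

context closed_subspace_quotient
begin

text \<open>Since \<open>Q\<^sup>*\<close> is injective with bounded inverse on its range
  \<open>R\<close>, composing \<open>w\<close> with this inverse gives a bounded functional on
  \<open>R\<close>. A Hahn-Banach extension to the whole dual of \<open>X\<close> is the preimage
  sought.\<close>

lemma biconjugate_quotient_surj:
  assumes w: "w \<in> carrier (bidual_space (quotient_space X N))"
  obtains \<eta> where "\<eta> \<in> carrier (bidual_space X)"
    "biconjugate X (quotient_space X N) (quotient_operator X N) \<eta> = w"
proof -
  let ?Q = "quotient_space X N" and ?q = "quotient_operator X N"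
  let ?c = "conjugate X ?Q ?q"
  interpret Q: normed_space ?Q by (rule normed_space_quotient)
  interpret DQ: normed_space "dual_space ?Q" by (rule Q.normed_space_dual)
  interpret D: normed_space "dual_space X" by (rule normed_space_dual)
  have bc: "bounded_operator (dual_space ?Q) (dual_space X) ?c"
    by (rule bounded_operator_conjugate[OF normed_space_axioms normed_space_quotient bounded_operator_quotient])
  define R where "R = ?c ` carrier (dual_space ?Q)"
  have R: "submodule R scalar_space (dual_space X)"
    unfolding R_def by (rule submodule_image[OF DQ.normed_space_axioms D.normed_space_axioms bc DQ.carrier_is_submodule])
  have inj: "inj_on ?c (carrier (dual_space ?Q))"
  proof (rule inj_onI)
    fix \<phi> \<psi> assume \<phi>: "\<phi> \<in> carrier (dual_space ?Q)" and \<psi>: "\<psi> \<in> carrier (dual_space ?Q)" and eq: "?c \<phi> = ?c \<psi>"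
    show "\<phi> = \<psi>"
    proof (rule dual_eqI[OF \<phi> \<psi>])
      fix A assume "A \<in> carrier ?Q"
      then obtain x where "x \<in> carrier X" "A = N +> x" by (rule quotient_cases)
      then show "\<phi> A = \<psi> A"
        using conjugate_quotient_apply[OF \<phi>] conjugate_quotient_apply[OF \<psi>] eq by metis
    qed
  qed
  define v where "v h = w (inv_into (carrier (dual_space ?Q)) ?c h)" for h
  have v: "v (?c \<psi>) = w \<psi>" if "\<psi> \<in> carrier (dual_space ?Q)" for \<psi>
    using inj that by (simp add: v_def)
  have "bounded_operator (subspace_of (dual_space X) R) scalar_space v"
  proof (rule bounded_operatorI)
    fix h assume "h \<in> carrier (subspace_of (dual_space X) R)"
    then obtain \<psi> where \<psi>: "\<psi> \<in> carrier (dual_space ?Q)" "h = ?c \<psi>" by (auto simp: R_def)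
    have "norm (w \<psi>) \<le> vnorm (bidual_space ?Q) w * vnorm (dual_space ?Q) \<psi>"
      by (rule DQ.dual_norm_bound[OF w \<psi>(1)])
    also have "\<dots> \<le> vnorm (bidual_space ?Q) w * vnorm (dual_space X) h"
      using mult_left_mono[OF conjugate_quotient_norm[OF \<psi>(1)] DQ.dual_norm_nonneg[OF w]] by (simp add: \<psi>(2))
    finally show "vnorm scalar_space (v h) \<le> vnorm (bidual_space ?Q) w * vnorm (subspace_of (dual_space X) R) h"
      using v[OF \<psi>(1)] by (simp add: \<psi>(2))
    show "v (c \<odot>\<^bsub>subspace_of (dual_space X) R\<^esub> h) = c \<odot>\<^bsub>scalar_space\<^esub> v h" for c
      using v[OF DQ.smult_in_carrier[OF \<psi>(1), of c]] v[OF \<psi>(1)] bounded_operatorD(3)[OF bc \<psi>(1), of c]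
        dualD(3)[OF w \<psi>(1), of c] by (simp add: \<psi>(2) del: dual_space_simps)
    fix k assume "k \<in> carrier (subspace_of (dual_space X) R)"
    then obtain \<phi> where \<phi>: "\<phi> \<in> carrier (dual_space ?Q)" "k = ?c \<phi>" by (auto simp: R_def)
    show "v (h \<oplus>\<^bsub>subspace_of (dual_space X) R\<^esub> k) = v h \<oplus>\<^bsub>scalar_space\<^esub> v k"
      using v[OF DQ.M.a_closed[OF \<psi>(1) \<phi>(1)]] v[OF \<psi>(1)] v[OF \<phi>(1)] bounded_operatorD(2)[OF bc \<psi>(1) \<phi>(1)]
        dualD(2)[OF w \<psi>(1) \<phi>(1)] by (simp add: \<psi>(2) \<phi>(2) del: dual_space_simps)
  qed simp
  then obtain u where u: "bounded_operator (dual_space X) scalar_space u" "\<And>h. h \<in> R \<Longrightarrow> u h = v h"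
    using D.hahn_banach[OF R] by blast
  define \<eta> where "\<eta> = (\<lambda>h\<in>carrier (dual_space X). u h)"
  have \<eta>: "\<eta> \<in> carrier (bidual_space X)"
    unfolding \<eta>_def by (rule D.restrict_in_dual[OF u(1)])
  have "biconjugate X ?Q ?q \<eta> = w"
  proof (rule dual_eqI[OF _ w])
    show "biconjugate X ?Q ?q \<eta> \<in> carrier (bidual_space ?Q)"
      by (rule biconjugate_in_bidual[OF normed_space_axioms normed_space_quotient bounded_operator_quotient \<eta>])
    fix \<psi> assume \<psi>: "\<psi> \<in> carrier (dual_space ?Q)"
    then show "biconjugate X ?Q ?q \<eta> \<psi> = w \<psi>"
      using u(2)[of "?c \<psi>"] v[OF \<psi>] bounded_operatorD(1)[OF bc \<psi>]
      unfolding biconjugate_apply[OF \<eta> \<psi>] by (simp add: \<eta>_def R_def)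
  qed
  then show ?thesis using \<eta> that by blast
qed

text \<open>Suppose that \<open>Q\<^sup>*\<^sup>*\<^sup>* \<xi>\<close> comes from a functional f on
  \<open>X\<close>, so that \<open>\<xi>\<close> takes the value \<open>\<eta> f\<close> at
  \<open>Q\<^sup>*\<^sup>* \<eta>\<close>. Testing with points of \<open>N\<close> shows that f
  vanishes on \<open>N\<close>, hence is \<open>Q\<^sup>* \<phi>\<close> for some
  \<open>\<phi>\<close>. As \<open>Q\<^sup>*\<^sup>*\<close> is onto, \<open>\<xi>\<close> is
  evaluation at \<open>\<phi>\<close>.\<close>

lemma cotauberian_quotient: "cotauberian X (quotient_space X N) (quotient_operator X N)"
proof -
  let ?Q = "quotient_space X N" and ?q = "quotient_operator X N"
  let ?c = "conjugate X ?Q ?q"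
  note X = normed_space_axioms
  interpret Q: normed_space ?Q by (rule normed_space_quotient)
  interpret DQ: normed_space "dual_space ?Q" by (rule Q.normed_space_dual)
  interpret BQ: normed_space "bidual_space ?Q" by (rule DQ.normed_space_dual)
  interpret D: normed_space "dual_space X" by (rule normed_space_dual)
  note bq = bounded_operator_quotient
  have bc: "bounded_operator (dual_space ?Q) (dual_space X) ?c"
    by (rule bounded_operator_conjugate[OF X normed_space_quotient bq])
  have "tauberian (dual_space ?Q) (dual_space X) ?c"
    unfolding tauberian_iff[OF DQ.normed_space_axioms D.normed_space_axioms bc]
  proof (intro ballI impI)
    fix \<xi> assume \<xi>: "\<xi> \<in> carrier (bidual_space (dual_space ?Q))"
      and "biconjugate (dual_space ?Q) (dual_space X) ?c \<xi> \<in> canonical_image (dual_space X)"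
    then obtain f where f: "f \<in> carrier (dual_space X)"
      and eq: "biconjugate (dual_space ?Q) (dual_space X) ?c \<xi> = canonical_functional (dual_space X) f"
      by (auto simp: canonical_image_eq)
    have \<xi>_biconj: "\<xi> (biconjugate X ?Q ?q \<eta>) = \<eta> f" if "\<eta> \<in> carrier (bidual_space X)" for \<eta>
      using fun_cong[OF eq, of \<eta>] that f by (simp add: biconjugate_apply[OF \<xi>])
    have "f x = 0" if x: "x \<in> N" for x
    proof -
      have xX: "x \<in> carrier X" using x N_subset by blast
      have "N +> x = \<zero>\<^bsub>?Q\<^esub>"
        using coset_eq_iff[OF xX M.zero_closed] x xX
        by (simp add: coset_zero quotient_space_simps(4) a_minus_def)
      then have "biconjugate X ?Q ?q (canonical_functional X x) = canonical_functional ?Q \<zero>\<^bsub>?Q\<^esub>"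
        using biconjugate_canonical[OF X normed_space_quotient bq xX] xX by simp
      also have "\<dots> = \<zero>\<^bsub>bidual_space ?Q\<^esub>"
        by (auto simp: canonical_functional_def fun_eq_iff Q.dual_zero_apply)
      finally have "\<xi> \<zero>\<^bsub>bidual_space ?Q\<^esub> = f x"
        using \<xi>_biconj[OF canonical_functional_in_bidual[OF X xX]] f by simp
      then show ?thesis
        using BQ.dual_zero_apply[OF \<xi>] by simp
    qed
    then obtain B where B: "bounded_operator ?Q scalar_space B" "\<And>x. x \<in> carrier X \<Longrightarrow> B (N +> x) = f x"
      using quotient_factor[OF normed_space_scalar_space dualD(1)[OF f]] by (metis scalar_space_simps(4))
    define \<phi> where "\<phi> = (\<lambda>A\<in>carrier ?Q. B A)"
    have \<phi>: "\<phi> \<in> carrier (dual_space ?Q)"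
      unfolding \<phi>_def by (rule Q.restrict_in_dual[OF B(1)])
    have c\<phi>: "?c \<phi> = f"
      by (rule dual_eqI[OF bounded_operatorD(1)[OF bc \<phi>] f])
        (simp add: conjugate_quotient_apply[OF \<phi>], simp add: \<phi>_def B)
    have "\<xi> = canonical_functional (dual_space ?Q) \<phi>"
    proof (rule dual_eqI[OF \<xi> canonical_functional_in_bidual[OF DQ.normed_space_axioms \<phi>]])
      fix w assume w: "w \<in> carrier (bidual_space ?Q)"
      then obtain \<eta> where \<eta>: "\<eta> \<in> carrier (bidual_space X)" "biconjugate X ?Q ?q \<eta> = w"
        by (rule biconjugate_quotient_surj)
      then show "\<xi> w = canonical_functional (dual_space ?Q) \<phi> w"
        using \<xi>_biconj[OF \<eta>(1)] biconjugate_apply[OF \<eta>(1) \<phi>, of ?q] w by (simp add: c\<phi>)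
    qed
    then show "\<xi> \<in> canonical_image (dual_space ?Q)"
      using \<phi> by (simp add: canonical_image_eq)
  qed
  then show ?thesis
    using bq by (simp add: cotauberian_def)
qed

text \<open>If the image of \<open>\<xi>\<close> in the bidual of \<open>X\<close> comes from x,
  then \<open>\<xi>\<close> sends the restriction of f to f x. Separation of points from a closed
  subspace puts x into \<open>N\<close>; as every functional on \<open>N\<close> is a restriction,
  \<open>\<xi>\<close> is evaluation at x.\<close>

lemma tauberian_inclusion: "tauberian (subspace_of X N) X (inclusion_operator N)"
proof -
  let ?N = "subspace_of X N" and ?j = "inclusion_operator N"
  note X = normed_space_axioms
  interpret S: normed_space ?N by (rule normed_space_subspace[OF submodule_N])
  interpret DN: normed_space "dual_space ?N" by (rule S.normed_space_dual)
  interpret Q: normed_space "quotient_space X N" by (rule normed_space_quotient)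
  have bj: "bounded_operator ?N X ?j"
    by (rule bounded_operator_inclusion[OF submodule_N])
  show ?thesis
    unfolding tauberian_iff[OF S.normed_space_axioms X bj]
  proof (intro ballI impI)
    fix \<xi> assume \<xi>: "\<xi> \<in> carrier (bidual_space ?N)" and "biconjugate ?N X ?j \<xi> \<in> canonical_image X"
    then obtain x where x: "x \<in> carrier X" and eq: "biconjugate ?N X ?j \<xi> = canonical_functional X x"
      by (auto simp: canonical_image_eq)
    have \<xi>_restr: "\<xi> (\<lambda>y\<in>N. f y) = f x" if f: "f \<in> carrier (dual_space X)" for f
    proof -
      have "conjugate ?N X ?j f = (\<lambda>y\<in>N. f y)"
        using f by (auto simp: conjugate_def inclusion_operator_def fun_eq_iff)
      then show ?thesis
        using fun_cong[OF eq, of f] f by (simp add: biconjugate_apply[OF \<xi> f])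
    qed
    have xN: "x \<in> N"
    proof (rule ccontr)
      assume "x \<notin> N"
      then have "N +> x \<noteq> \<zero>\<^bsub>quotient_space X N\<^esub>"
        using N.a_rcos_self[OF x] by (auto simp: quotient_space_simps(4))
      then obtain g where g: "bounded_operator (quotient_space X N) scalar_space g" "g (N +> x) \<noteq> 0"
        using Q.functional_separates[OF coset_in_quotient[OF x]] by blast
      \<comment> \<open>A functional on the quotient pulls back to one that vanishes on
        \<open>N\<close> but not at \<open>x\<close>. Its restriction is zero, so
        \<open>\<xi>\<close> would give f x = 0.\<close>
      define f where "f = (\<lambda>y\<in>carrier X. g (quotient_operator X N y))"
      have f: "f \<in> carrier (dual_space X)"
        unfolding f_def
        by (rule restrict_in_dual[OF bounded_operator_comp[OF bounded_operator_quotient g(1) Q.normed_space_axioms]])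
      have "f y = 0" if y: "y \<in> N" for y
      proof -
        have yX: "y \<in> carrier X" using y N_subset by blast
        have "N +> y = \<zero>\<^bsub>quotient_space X N\<^esub>"
          using coset_eq_iff[OF yX M.zero_closed] y yX
          by (simp add: coset_zero quotient_space_simps(4) a_minus_def)
        then show ?thesis
          using yX Q.bounded_operator_zero[OF g(1) normed_space_scalar_space] by (simp add: f_def)
      qed
      then have "(\<lambda>y\<in>N. f y) = \<zero>\<^bsub>dual_space ?N\<^esub>"
        by (auto simp: fun_eq_iff)
      then have "f x = 0"
        using \<xi>_restr[OF f] DN.dual_zero_apply[OF \<xi>] by simp
      then show False using g(2) x by (simp add: f_def)
    qed
    have "\<xi> = canonical_functional ?N x"
    proof (rule dual_eqI[OF \<xi> canonical_functional_in_bidual[OF S.normed_space_axioms]])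
      show "x \<in> carrier ?N" using xN by simp
      fix g assume g: "g \<in> carrier (dual_space ?N)"
      obtain f where f: "bounded_operator X scalar_space f" "\<And>y. y \<in> N \<Longrightarrow> f y = g y"
        using hahn_banach[OF submodule_N dualD(1)[OF g]] by blast
      define f' where "f' = (\<lambda>y\<in>carrier X. f y)"
      have f': "f' \<in> carrier (dual_space X)"
        unfolding f'_def by (rule restrict_in_dual[OF f(1)])
      have "(\<lambda>y\<in>N. f' y) = g"
        using g f(2) N_subset
        by (intro extensionalityI[of _ N]) (auto simp: in_dual_iff f'_def)
      then have "\<xi> g = f' x"
        using \<xi>_restr[OF f'] by simp
      then show "\<xi> g = canonical_functional ?N x g"
        using g x xN f(2) by (simp add: f'_def)
    qed
    then show "\<xi> \<in> canonical_image ?N"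
      using xN by (simp add: canonical_image_eq)
  qed
qed

end


section \<open>Preimages and closures of images of closed subspaces\<close>

lemma closed_subspace_vimage:
  assumes X: "normed_space X" and Y: "normed_space Y" and T: "bounded_operator X Y T"
    and M: "closed_subspace Y M"
  shows "closed_subspace X (T -` M \<inter> carrier X)"
proof -
  interpret X: normed_space X by fact
  interpret Y: normed_space Y by fact
  have sM: "submodule M scalar_space Y" using M by (simp add: closed_subspace_def)
  note T' = bounded_operatorD[OF T]
  have "submodule (T -` M \<inter> carrier X) scalar_space X"
    by (rule X.submoduleI')
      (use Y.submodule_zero[OF sM] Y.submoduleE(4,5)[OF sM] X.bounded_operator_zero[OF T Y] in \<open>auto simp: T'\<close>)
  moreover have "T x \<in> M"
    if x: "x \<in> carrier X" and lim: "\<And>e. e > 0 \<Longrightarrow> \<exists>y\<in>T -` M \<inter> carrier X. vnorm X (x \<ominus>\<^bsub>X\<^esub> y) < e" for x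
  proof -
    obtain C where C: "0 \<le> C" "\<And>x. x \<in> carrier X \<Longrightarrow> vnorm Y (T x) \<le> C * vnorm X x"
      using X.bounded_operator_bound[OF T] by blast
    have "\<exists>y\<in>M. vnorm Y (T x \<ominus>\<^bsub>Y\<^esub> y) < e" if "e > 0" for e
    proof -
      \<comment> \<open>\<open>C\<close> may be 0, hence the denominator
        \<open>C + 1\<close>.\<close>
      have "e / (C + 1) > 0" using \<open>e > 0\<close> C(1) by simp
      then obtain y where y: "T y \<in> M" "y \<in> carrier X" "vnorm X (x \<ominus>\<^bsub>X\<^esub> y) < e / (C + 1)"
        using lim by blast
      have "vnorm Y (T x \<ominus>\<^bsub>Y\<^esub> T y) \<le> C * vnorm X (x \<ominus>\<^bsub>X\<^esub> y)"
        using C(2)[of "x \<ominus>\<^bsub>X\<^esub> y"] X.bounded_operator_diff[OF T Y x y(2)] x y(2) by simp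
      also have "\<dots> \<le> (C + 1) * vnorm X (x \<ominus>\<^bsub>X\<^esub> y)"
        using x y(2) by (intro mult_right_mono X.vnorm_nonneg) simp_all
      also have "\<dots> < e"
        using y(3) C(1) by (simp add: pos_less_divide_eq mult.commute)
      finally show ?thesis using y(1) by blast
    qed
    then show ?thesis
      using M T'(1)[OF x] by (auto simp: Y.closed_subspace_iff)
  qed
  ultimately show ?thesis
    unfolding X.closed_subspace_iff by auto
qed

text \<open>Addition and scalar multiplication are continuous, so approximations from
  \<open>M\<close> add and scale to approximations from \<open>M\<close>.\<close>

lemma (in normed_space) closed_subspace_closure:
  assumes M: "submodule M scalar_space X"
  shows "closed_subspace X (norm_topology X closure_of M)"
proof -
  note M' = submoduleE[OF M]
  let ?K = "norm_topology X closure_of M"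
  have car: "y \<in> carrier X" if "y \<in> M" for y using that M'(1) by blast
  have "submodule ?K scalar_space X"
  proof (rule submoduleI')
    show "?K \<subseteq> carrier X" by (auto simp: closure_of_eq[OF M'(1)])
    show "\<zero> \<in> ?K" using subset_closure[OF M'(1)] submodule_zero[OF M] by blast
    fix x assume "x \<in> ?K"
    then have x: "x \<in> carrier X" "\<And>e. e > 0 \<Longrightarrow> \<exists>y\<in>M. vnorm X (x \<ominus> y) < e"
      by (auto simp: closure_of_eq[OF M'(1)])
    show "c \<odot> x \<in> ?K" for c
    proof -
      have "\<exists>y\<in>M. vnorm X ((c \<odot> x) \<ominus> y) < e" if "e > 0" for e
      proof -
        have pos: "norm c + 1 > 0" by (simp add: add_nonneg_pos)
        then have "e / (norm c + 1) > 0" using \<open>e > 0\<close> by simp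
        then obtain y where y: "y \<in> M" "vnorm X (x \<ominus> y) < e / (norm c + 1)"
          using x(2) by blast
        have "(c \<odot> x) \<ominus> (c \<odot> y) = c \<odot> (x \<ominus> y)"
          using x(1) car[OF y(1)] by (simp add: diff_eq_smult smult_add_right smult_smult)
        then have "vnorm X ((c \<odot> x) \<ominus> (c \<odot> y)) = norm c * vnorm X (x \<ominus> y)"
          using x(1) car[OF y(1)] by (simp add: vnorm_smult)
        also have "\<dots> \<le> (norm c + 1) * vnorm X (x \<ominus> y)"
          using x(1) car[OF y(1)] by (intro mult_right_mono vnorm_nonneg) simp_all
        also have "\<dots> < e"
          using y(2) pos by (simp add: pos_less_divide_eq mult.commute)
        finally show ?thesis using M'(4)[of c y] y(1) by auto
      qed
      then show ?thesis using x(1) by (simp add: closure_of_eq[OF M'(1)])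
    qed
    fix z assume "z \<in> ?K"
    then have z: "z \<in> carrier X" "\<And>e. e > 0 \<Longrightarrow> \<exists>y\<in>M. vnorm X (z \<ominus> y) < e"
      by (auto simp: closure_of_eq[OF M'(1)])
    have "\<exists>y\<in>M. vnorm X ((x \<oplus> z) \<ominus> y) < e" if "e > 0" for e
    proof -
      have "e / 2 > 0" using \<open>e > 0\<close> by simp
      then obtain y w where y: "y \<in> M" "vnorm X (x \<ominus> y) < e / 2" and w: "w \<in> M" "vnorm X (z \<ominus> w) < e / 2"
        using x(2) z(2) by blast
      have "(x \<oplus> z) \<ominus> (y \<oplus> w) = (x \<ominus> y) \<oplus> (z \<ominus> w)"
        using x(1) z(1) car[OF y(1)] car[OF w(1)] by (simp add: a_minus_def M.minus_add M.a_ac)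
      then have "vnorm X ((x \<oplus> z) \<ominus> (y \<oplus> w)) < e"
        using vnorm_triangle[of "x \<ominus> y" "z \<ominus> w"] x(1) z(1) car[OF y(1)] car[OF w(1)] y(2) w(2) by simp
      then show ?thesis using M'(5)[OF y(1) w(1)] by blast
    qed
    then show "x \<oplus> z \<in> ?K"
      using x(1) z(1) by (simp add: closure_of_eq[OF M'(1)])
  qed
  then show ?thesis
    by (simp add: closed_subspace_def)
qed

section \<open>Restricted and induced operators\<close>

lemma inclusion_operator_apply: "x \<in> M \<Longrightarrow> inclusion_operator M x = x"
  by (simp add: inclusion_operator_def)

lemma bounded_operator_subspaces:
  assumes "bounded_operator X Y T" "M \<subseteq> carrier X" "\<And>x. x \<in> M \<Longrightarrow> T x \<in> M'"
  shows "bounded_operator (subspace_of X M) (subspace_of Y M') T"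
proof -
  obtain C where "\<forall>x\<in>carrier X. vnorm Y (T x) \<le> C * vnorm X x"
    using assms(1) unfolding bounded_operator_def by blast
  then show ?thesis
    using assms(2,3) bounded_operatorD[OF assms(1)]
    by (intro bounded_operatorI[where C = C]) (auto simp: subset_iff)
qed

lemma closed_subspace_quotientI: "normed_space X \<Longrightarrow> closed_subspace X N \<Longrightarrow> closed_subspace_quotient X N"
  by (simp add: closed_subspace_quotient_def closed_subspace_quotient_axioms_def)

text \<open>The composition of \<open>T\<close> with the quotient map onto \<open>Y/N'\<close> kills
  \<open>N\<close>, so it factors through \<open>X/N\<close>. Preimages and closures of images both
  satisfy the hypothesis on \<open>N\<close> and \<open>N'\<close>.\<close>

lemma quotient_operator_factor:
  assumes X: "normed_space X" and Y: "normed_space Y" and T: "bounded_operator X Y T"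
    and N: "closed_subspace X N" and N': "closed_subspace Y N'" and TN: "\<And>x. x \<in> N \<Longrightarrow> T x \<in> N'"
  obtains B where "bounded_operator (quotient_space X N) (quotient_space Y N') B"
    "\<And>x. x \<in> carrier X \<Longrightarrow> B (quotient_operator X N x) = quotient_operator Y N' (T x)"
proof -
  interpret QX: closed_subspace_quotient X N by (rule closed_subspace_quotientI[OF X N])
  interpret QY: closed_subspace_quotient Y N' by (rule closed_subspace_quotientI[OF Y N'])
  have b: "bounded_operator X (quotient_space Y N') (\<lambda>x. quotient_operator Y N' (T x))"
    by (rule QX.bounded_operator_comp[OF T QY.bounded_operator_quotient Y])
  have "quotient_operator Y N' (T x) = \<zero>\<^bsub>quotient_space Y N'\<^esub>" if "x \<in> N" for x
  proof -
    have "T x \<in> carrier Y" "T x \<in> N'"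
      using bounded_operatorD(1)[OF T] QX.N_subset TN that by blast+
    then show ?thesis
      using QY.coset_eq_iff[of "T x" "\<zero>\<^bsub>Y\<^esub>"]
      by (simp add: QY.coset_zero quotient_space_simps(4) a_minus_def)
  qed
  then obtain B where "bounded_operator (quotient_space X N) (quotient_space Y N') B"
    "\<And>x. x \<in> carrier X \<Longrightarrow> B (N +>\<^bsub>X\<^esub> x) = quotient_operator Y N' (T x)"
    using QX.quotient_factor[OF QY.normed_space_quotient b] by blast
  then show ?thesis
    using that by simp
qed

section \<open>Pairs of preimages and of closures of images\<close>

lemma tauberian_pair_vimage:
  assumes X: "normed_space X" and Y: "normed_space Y" and T: "tauberian X Y T"
    and MN: "tauberian_pair Y M N"
  shows "tauberian_pair X (T -` M \<inter> carrier X) (T -` N \<inter> carrier X)"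
proof -
  let ?M = "T -` M \<inter> carrier X" and ?N = "T -` N \<inter> carrier X"
  have bT: "bounded_operator X Y T" using T by (simp add: tauberian_def)
  have cM: "closed_subspace Y M" and cN: "closed_subspace Y N"
    and tMN: "tauberian (subspace_of Y M) (quotient_space Y N) (quotient_operator Y N \<circ> inclusion_operator M)"
    using MN by (simp_all add: tauberian_pair_def)
  have cM': "closed_subspace X ?M" and cN': "closed_subspace X ?N"
    by (rule closed_subspace_vimage[OF X Y bT cM], rule closed_subspace_vimage[OF X Y bT cN])
  interpret YM: closed_subspace_quotient Y M by (rule closed_subspace_quotientI[OF Y cM])
  interpret YN: closed_subspace_quotient Y N by (rule closed_subspace_quotientI[OF Y cN])
  interpret XM: closed_subspace_quotient X ?M by (rule closed_subspace_quotientI[OF X cM'])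
  interpret XN: closed_subspace_quotient X ?N by (rule closed_subspace_quotientI[OF X cN'])
  have nM: "normed_space (subspace_of Y M)" and nM': "normed_space (subspace_of X ?M)"
    by (rule YM.normed_space_subspace[OF YM.submodule_N], rule XM.normed_space_subspace[OF XM.submodule_N])
  note nN = YN.normed_space_quotient and nN' = XN.normed_space_quotient
  have bTM: "bounded_operator (subspace_of X ?M) (subspace_of Y M) T"
    by (rule bounded_operator_subspaces[OF bT Int_lower2]) (erule IntE, erule vimageD)
  have "tauberian (subspace_of X ?M) Y T"
    by (rule tauberian_comp[OF nM' X Y XM.tauberian_inclusion T])
      (simp only: inclusion_operator_apply subspace_of_simps)
  \<comment> \<open>As a map into \<open>Y\<close> the restriction of \<open>T\<close> is its map
    into \<open>M\<close> followed by the inclusion, so shrinking the target keeps it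
    tauberian.\<close>
  then have "tauberian (subspace_of X ?M) (subspace_of Y M) T"
    by (rule tauberian_right_factor[OF nM' nM Y bTM YM.bounded_operator_inclusion[OF YM.submodule_N], rotated])
      (simp only: inclusion_operator_apply subspace_of_simps Int_iff vimage_eq)
  then have t: "tauberian (subspace_of X ?M) (quotient_space Y N) (\<lambda>x. quotient_operator Y N (T x))"
    by (rule tauberian_comp[OF nM' nM nN _ tMN])
      (simp only: o_apply inclusion_operator_apply subspace_of_simps Int_iff vimage_eq)
  obtain B where B: "bounded_operator (quotient_space X ?N) (quotient_space Y N) B"
    "\<And>x. x \<in> carrier X \<Longrightarrow> B (quotient_operator X ?N x) = quotient_operator Y N (T x)"
    using quotient_operator_factor[OF X Y bT cN' cN] by blast
  have b: "bounded_operator (subspace_of X ?M) (quotient_space X ?N) (quotient_operator X ?N \<circ> inclusion_operator ?M)"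
    by (rule bounded_operator_comp_cong[OF nM' X XM.bounded_operator_inclusion[OF XM.submodule_N]
          XN.bounded_operator_quotient]) (simp only: o_apply)
  \<comment> \<open>The tauberian operator \<open>t\<close> equals \<open>B\<close> after the
    operator of the new pair, which is thus a right factor.\<close>
  have "tauberian (subspace_of X ?M) (quotient_space X ?N) (quotient_operator X ?N \<circ> inclusion_operator ?M)"
    by (rule tauberian_right_factor[OF nM' nN' nN b B(1) _ t])
      (simp only: o_apply inclusion_operator_apply subspace_of_simps Int_iff B(2))
  then show ?thesis
    using cM' cN' by (simp add: tauberian_pair_def)
qed

lemma cotauberian_pair_closure_image:
  assumes X: "normed_space X" and Y: "normed_space Y" and T: "cotauberian X Y T"
    and MN: "cotauberian_pair X M N"
  shows "cotauberian_pair Y (norm_topology Y closure_of (T ` M)) (norm_topology Y closure_of (T ` N))"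
proof -
  let ?M = "norm_topology Y closure_of (T ` M)" and ?N = "norm_topology Y closure_of (T ` N)"
  interpret Y: normed_space Y by fact
  have bT: "bounded_operator X Y T" using T by (simp add: cotauberian_def)
  have cM: "closed_subspace X M" and cN: "closed_subspace X N"
    and tMN: "cotauberian (subspace_of X M) (quotient_space X N) (quotient_operator X N \<circ> inclusion_operator M)"
    using MN by (simp_all add: cotauberian_pair_def)
  interpret XM: closed_subspace_quotient X M by (rule closed_subspace_quotientI[OF X cM])
  interpret XN: closed_subspace_quotient X N by (rule closed_subspace_quotientI[OF X cN])
  have sM: "submodule (T ` M) scalar_space Y" and sN: "submodule (T ` N) scalar_space Y"
    by (rule submodule_image[OF X Y bT XM.submodule_N], rule submodule_image[OF X Y bT XN.submodule_N])
  have cM': "closed_subspace Y ?M" and cN': "closed_subspace Y ?N"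
    by (rule Y.closed_subspace_closure[OF sM], rule Y.closed_subspace_closure[OF sN])
  have TM: "T x \<in> ?M" if "x \<in> M" for x
    using Y.subset_closure[OF Y.submoduleE(1)[OF sM]] that by blast
  have TN: "T x \<in> ?N" if "x \<in> N" for x
    using Y.subset_closure[OF Y.submoduleE(1)[OF sN]] that by blast
  interpret YM: closed_subspace_quotient Y ?M by (rule closed_subspace_quotientI[OF Y cM'])
  interpret YN: closed_subspace_quotient Y ?N by (rule closed_subspace_quotientI[OF Y cN'])
  have nM: "normed_space (subspace_of X M)" and nM': "normed_space (subspace_of Y ?M)"
    by (rule XM.normed_space_subspace[OF XM.submodule_N], rule Y.normed_space_subspace[OF YM.submodule_N])
  note nN = XN.normed_space_quotient and nN' = YN.normed_space_quotient
  have bTM: "bounded_operator (subspace_of X M) (subspace_of Y ?M) T"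
    by (rule bounded_operator_subspaces[OF bT XM.N_subset TM])
  obtain B where B: "bounded_operator (quotient_space X N) (quotient_space Y ?N) B"
    "\<And>x. x \<in> carrier X \<Longrightarrow> B (quotient_operator X N x) = quotient_operator Y ?N (T x)"
    using quotient_operator_factor[OF X Y bT cN cN' TN] by blast
  have "cotauberian X (quotient_space Y ?N) (\<lambda>x. quotient_operator Y ?N (T x))"
    by (rule cotauberian_comp[OF X Y nN' T YN.cotauberian_quotient]) simp
  \<comment> \<open>The operator just obtained is \<open>B\<close> after the quotient map of
    \<open>X\<close>, so \<open>B\<close> is a left factor of it.\<close>
  then have cB: "cotauberian (quotient_space X N) (quotient_space Y ?N) B"
    by (rule cotauberian_left_factor[OF X nN nN' XN.bounded_operator_quotient B(1), rotated])
      (simp only: B(2))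
  have c: "cotauberian (subspace_of X M) (quotient_space Y ?N) (\<lambda>x. quotient_operator Y ?N (T x))"
    by (rule cotauberian_comp[OF nM nN nN' tMN cB])
      (use XM.N_subset B(2) in \<open>auto simp: inclusion_operator_def subset_iff simp del: XN.quotient_operator_apply YN.quotient_operator_apply\<close>)
  have b: "bounded_operator (subspace_of Y ?M) (quotient_space Y ?N) (quotient_operator Y ?N \<circ> inclusion_operator ?M)"
    by (rule bounded_operator_comp_cong[OF nM' Y Y.bounded_operator_inclusion[OF YM.submodule_N]
          YN.bounded_operator_quotient]) (simp only: o_apply)
  \<comment> \<open>The cotauberian operator \<open>c\<close> is the operator of the new pair after
    the restriction of \<open>T\<close> to \<open>M\<close>, so that operator is a left
    factor.\<close>
  have "cotauberian (subspace_of Y ?M) (quotient_space Y ?N) (quotient_operator Y ?N \<circ> inclusion_operator ?M)"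
    by (rule cotauberian_left_factor[OF nM nM' nN' bTM b _ c])
      (use TM in \<open>simp add: inclusion_operator_def\<close>)
  then show ?thesis
    using cM' cN' by (simp add: cotauberian_pair_def)
qed

theorem theorem3p9:
  fixes X :: "('k::real_or_complex, 'a) normed_module"
    and Y :: "('k, 'b) normed_module"
    and T :: "'a \<Rightarrow> 'b"
  assumes "banach_space X" and "banach_space Y" and "bounded_operator X Y T"
  shows "(tauberian X Y T \<longrightarrow>
           (\<forall>M N. tauberian_pair Y M N \<longrightarrow>
              tauberian_pair X (T -` M \<inter> carrier X) (T -` N \<inter> carrier X)))
       \<and> (cotauberian X Y T \<longrightarrow>
           (\<forall>M N. cotauberian_pair X M N \<longrightarrow>
              cotauberian_pair Y (norm_topology Y closure_of (T ` M))
                (norm_topology Y closure_of (T ` N))))"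
  using assms tauberian_pair_vimage cotauberian_pair_closure_image unfolding banach_space_def by blast

end
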